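(* Let $T\in\mathbb{B}(\mathcal{H})$ be a bounded linear operator on a complex Hilbert space $\mathcal{H}$ and let $\lambda\in[0,1]$. Then $$2\sqrt{\lambda-\lambda^2}\,\omega(\widetilde{T})\le\omega\big(M_\lambda(T)\big)\le\lambda\,\omega(T)+(1-\lambda)\,\omega(T^D).$$ In particular, $$2\sqrt{\lambda-\lambda^2}\,r(T)\le\omega\big(M_\lambda(T)\big)\le\omega(T).$$
   Context: $\mathbb{B}(\mathcal{H})$ is the algebra of bounded linear operators on the complex Hilbert space $\mathcal{H}$, $r(T)$ is the spectral radius, and $\omega(A)=\sup\{|\langle Ax,x\rangle|:\ x\in\mathcal{H},\ \|x\|=1\}$ is the numerical radius. $T=U|T|$ denotes the canonical polar decomposition: $|T|=(T^*T)^{1/2}$ and $U$ is the unique partial isometry with $T=U|T|$ and $\mathcal{N}(U)=\mathcal{N}(T)$ (null spaces). The Duggal transform of $T$ is $T^D:=|T|U$; the Aluthge transform is $\widetilde{T}:=|T|^{1/2}U|T|^{1/2}$. For $\lambda\in[0,1]$ the $\lambda$-mean transform of $T$ is $M_\lambda(T):=\lambda T+(1-\lambda)T^D$. *)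

theory Defs
  imports "HOL-Analysis.Analysis"
begin

text \<open>
  A complex Hilbert space is rendered as a type class. The real structure inherited from
  \<^class>\<open>real_inner\<close> is tied to the complex one: real scalars act as complex ones, and the real inner
  product is the real part of the complex one, so that the norm is the one induced by the complex
  inner product. The latter is linear in its first argument.
\<close>

class complex_vector = real_vector +
  fixes scaleC :: "complex \<Rightarrow> 'a \<Rightarrow> 'a"  (infixr "*\<^sub>C" 75)
  assumes scaleC_add_right: "c *\<^sub>C (x + y) = c *\<^sub>C x + c *\<^sub>C y"
    and scaleC_add_left: "(c + d) *\<^sub>C x = c *\<^sub>C x + d *\<^sub>C x"
    and scaleC_scaleC: "c *\<^sub>C d *\<^sub>C x = (c * d) *\<^sub>C x"
    and scaleC_of_real: "complex_of_real r *\<^sub>C x = r *\<^sub>R x"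

class complex_inner = complex_vector + real_inner +
  fixes cinner :: "'a \<Rightarrow> 'a \<Rightarrow> complex"
  assumes cinner_commute: "cinner x y = cnj (cinner y x)"
    and cinner_add_left: "cinner (x + y) z = cinner x z + cinner y z"
    and cinner_scaleC_left: "cinner (c *\<^sub>C x) y = c * cinner x y"
    and Re_cinner: "Re (cinner x y) = inner x y"

class complex_hilbert_space = complex_inner + banach

definition bounded_clinear :: "('a::complex_hilbert_space \<Rightarrow> 'a) \<Rightarrow> bool" where
  "bounded_clinear T \<longleftrightarrow> bounded_linear T \<and> (\<forall>c x. T (c *\<^sub>C x) = c *\<^sub>C T x)"

text \<open>
  Inserting 0 in the two suprema below only matters on the zero space, where the sets are empty and
  the supremum of nonnegative quantities is 0; on \<^typ>\<open>real\<close>, the value \<open>Sup {}\<close> is unspecified.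
\<close>

definition numerical_radius :: "('a::complex_hilbert_space \<Rightarrow> 'a) \<Rightarrow> real" where
  "numerical_radius A = Sup (insert 0 {cmod (cinner (A x) x) |x. norm x = 1})"

definition op_spectrum :: "('a::complex_hilbert_space \<Rightarrow> 'a) \<Rightarrow> complex set" where
  "op_spectrum T =
     {c. \<not> (\<exists>S. bounded_clinear S \<and> (\<forall>x. S (T x - c *\<^sub>C x) = x) \<and> (\<forall>x. T (S x) - c *\<^sub>C S x = x))}"

definition spectral_radius :: "('a::complex_hilbert_space \<Rightarrow> 'a) \<Rightarrow> real" where
  "spectral_radius T = Sup (insert 0 (cmod ` op_spectrum T))"

definition op_adjoint :: "('a::complex_hilbert_space \<Rightarrow> 'a) \<Rightarrow> 'a \<Rightarrow> 'a" where
  "op_adjoint T = (THE S. bounded_clinear S \<and> (\<forall>x y. cinner (T x) y = cinner x (S y)))"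

definition positive_op :: "('a::complex_hilbert_space \<Rightarrow> 'a) \<Rightarrow> bool" where
  "positive_op A \<longleftrightarrow> bounded_clinear A \<and> (\<forall>x. cinner (A x) x \<in> \<real> \<and> 0 \<le> Re (cinner (A x) x))"

definition op_sqrt :: "('a::complex_hilbert_space \<Rightarrow> 'a) \<Rightarrow> 'a \<Rightarrow> 'a" where
  "op_sqrt A = (THE B. positive_op B \<and> B \<circ> B = A)"

definition op_abs :: "('a::complex_hilbert_space \<Rightarrow> 'a) \<Rightarrow> 'a \<Rightarrow> 'a" where
  "op_abs T = op_sqrt (op_adjoint T \<circ> T)"

definition null_space :: "('a::complex_hilbert_space \<Rightarrow> 'a) \<Rightarrow> 'a set" where
  "null_space T = {x. T x = 0}"

definition partial_isometry :: "('a::complex_hilbert_space \<Rightarrow> 'a) \<Rightarrow> bool" where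
  "partial_isometry U \<longleftrightarrow> bounded_clinear U \<and>
     (\<forall>x. (\<forall>y\<in>null_space U. cinner x y = 0) \<longrightarrow> norm (U x) = norm x)"

definition polar_isometry :: "('a::complex_hilbert_space \<Rightarrow> 'a) \<Rightarrow> 'a \<Rightarrow> 'a" where
  "polar_isometry T =
     (THE U. partial_isometry U \<and> T = U \<circ> op_abs T \<and> null_space U = null_space T)"

definition duggal :: "('a::complex_hilbert_space \<Rightarrow> 'a) \<Rightarrow> 'a \<Rightarrow> 'a" where
  "duggal T = op_abs T \<circ> polar_isometry T"

definition aluthge :: "('a::complex_hilbert_space \<Rightarrow> 'a) \<Rightarrow> 'a \<Rightarrow> 'a" where
  "aluthge T = op_sqrt (op_abs T) \<circ> polar_isometry T \<circ> op_sqrt (op_abs T)"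

definition mean_transform :: "real \<Rightarrow> ('a::complex_hilbert_space \<Rightarrow> 'a) \<Rightarrow> 'a \<Rightarrow> 'a" where
  "mean_transform l T = (\<lambda>x. l *\<^sub>R T x + (1 - l) *\<^sub>R duggal T x)"

end

theory Submission
  imports Defs
begin

text \<open>
  Put \<open>P = |T|\<close>, \<open>A = P\<^sup>1\<^sup>/\<^sup>2\<close>, \<open>W = AUA\<close> (the Aluthge transform) and \<open>M = \<lambda>UP + (1 - \<lambda>)PU\<close>.
  Formally \<open>M = \<lambda> A\<inverse>WA + (1 - \<lambda>) AWA\<inverse>\<close>, so the first inequality reads
  \<open>2 \<omega>(W) \<le> \<omega>(c\<inverse> A\<inverse>WA + c AWA\<inverse>)\<close> with \<open>c\<^sup>2 = (1 - \<lambda>)/\<lambda>\<close>. The scalar \<open>c\<close> is absorbed by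
  tensoring with the truncated shift \<open>V\<close> and replacing \<open>A\<close> by \<open>A \<otimes> diag(c\<^sup>n)\<close>, at the cost of a factor
  \<open>N/(N + 1)\<close>; after that the real part of the right-hand side is \<open>B\<inverse>HB + BHB\<inverse>\<close> with \<open>H\<close> self-adjoint,
  and evaluating it at \<open>Bx\<close> for an approximate eigenvector \<open>x\<close> of \<open>H\<close> gives the bound. Multiplying out
  the powers of \<open>B\<close> removes all inverses, so \<open>A\<close> need not be invertible.

  Moreover \<open>\<langle>PUx, x\<rangle> = \<langle>TUx, Ux\<rangle>\<close> gives \<open>\<omega>(T\<^sup>D) \<le> \<omega>(T)\<close>, and \<open>T = (UA)A\<close> has the same nonzero
  spectrum as \<open>A(UA)\<close>, whose spectral radius is at most its numerical radius by Lax--Milgram.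
\<close>

section \<open>Complex inner products, projections and adjoints\<close>

lemma scaleC_zero_right [simp]: "c *\<^sub>C (0::'a::complex_vector) = 0"
  by (metis add_cancel_right_left scaleC_add_right)

lemma scaleC_minus_right: "c *\<^sub>C (- x::'a::complex_vector) = - (c *\<^sub>C x)"
  by (metis add.right_inverse add_eq_0_iff scaleC_add_right scaleC_zero_right)

lemma scaleC_diff_right: "c *\<^sub>C (x - y::'a::complex_vector) = c *\<^sub>C x - c *\<^sub>C y"
  by (metis diff_conv_add_uminus scaleC_add_right scaleC_minus_right)

lemma scaleC_one [simp]: "1 *\<^sub>C (x::'a::complex_vector) = x"
  using scaleC_of_real[of 1 x] by simp

lemma scaleC_minus_one: "(-1) *\<^sub>C (x::'a::complex_vector) = - x"
  using scaleC_of_real[of "-1" x] by simp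

lemma scaleC_scaleR_commute: "c *\<^sub>C (r *\<^sub>R x::'a::complex_vector) = r *\<^sub>R (c *\<^sub>C x)"
  by (metis mult.commute scaleC_of_real scaleC_scaleC)

lemma cinner_add_right: "cinner (x::'a::complex_inner) (y + z) = cinner x y + cinner x z"
  by (metis cinner_add_left cinner_commute complex_cnj_add)

lemma cinner_scaleC_right: "cinner (x::'a::complex_inner) (c *\<^sub>C y) = cnj c * cinner x y"
  by (metis cinner_commute cinner_scaleC_left complex_cnj_mult)

lemma cinner_scaleR_left: "cinner (r *\<^sub>R x::'a::complex_inner) y = of_real r * cinner x y"
  by (metis cinner_scaleC_left scaleC_of_real)

lemma cinner_scaleR_right: "cinner (x::'a::complex_inner) (r *\<^sub>R y) = of_real r * cinner x y"
  by (metis cinner_scaleC_right scaleC_of_real complex_cnj_complex_of_real)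

lemma cinner_minus_left: "cinner (- x::'a::complex_inner) y = - cinner x y"
  using cinner_scaleR_left[of "-1" x y] by simp

lemma cinner_minus_right: "cinner (x::'a::complex_inner) (- y) = - cinner x y"
  using cinner_scaleR_right[of x "-1" y] by simp

lemma cinner_diff_left: "cinner (x - z::'a::complex_inner) y = cinner x y - cinner z y"
  by (metis cinner_add_left cinner_minus_left diff_conv_add_uminus)

lemma cinner_diff_right: "cinner (x::'a::complex_inner) (y - z) = cinner x y - cinner x z"
  by (metis cinner_add_right cinner_minus_right diff_conv_add_uminus)

lemma cinner_zero_left [simp]: "cinner (0::'a::complex_inner) y = 0"
  using cinner_scaleR_left[of 0 0 y] by simp

lemma cinner_zero_right [simp]: "cinner (x::'a::complex_inner) 0 = 0"
  using cinner_scaleR_right[of x 0 0] by simp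

lemmas cinner_simps = cinner_add_left cinner_add_right cinner_diff_left cinner_diff_right
  cinner_scaleC_left cinner_scaleC_right cinner_scaleR_left cinner_scaleR_right

lemma cinner_sum_left: "cinner (\<Sum>i\<in>I. f i::'a::complex_inner) y = (\<Sum>i\<in>I. cinner (f i) y)"
  by (induction I rule: infinite_finite_induct) (auto simp: cinner_add_left)

lemma cinner_sum_right: "cinner (x::'a::complex_inner) (\<Sum>i\<in>I. f i) = (\<Sum>i\<in>I. cinner x (f i))"
  by (induction I rule: infinite_finite_induct) (auto simp: cinner_add_right)

lemma cinner_self: "cinner (x::'a::complex_inner) x = of_real ((norm x)\<^sup>2)"
proof -
  have "Im (cinner x x) = 0"
    using cinner_commute[of x x] by (metis complex_cnj_cancel_iff Reals_cnj_iff complex_is_Real_iff)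
  then show ?thesis by (auto simp: complex_eq_iff Re_cinner power2_norm_eq_inner)
qed

text \<open>With \<open>Re_cinner\<close> this reduces complex orthogonality and limits to the real
  inner product: the imaginary part is a real part after rotating one argument by
  \<open>\<i>\<close>.\<close>

lemma Im_cinner: "Im (cinner x y) = inner (x::'a::complex_inner) (\<i> *\<^sub>C y)"
  by (simp add: cinner_scaleC_right flip: Re_cinner)

lemma norm_scaleC: "norm (c *\<^sub>C x::'a::complex_inner) = cmod c * norm x"
proof -
  have "complex_of_real ((norm (c *\<^sub>C x))\<^sup>2) = c * cnj c * of_real ((norm x)\<^sup>2)"
    unfolding cinner_self[symmetric] by (simp add: cinner_simps)
  also have "\<dots> = of_real ((cmod c * norm x)\<^sup>2)"
    by (simp add: complex_norm_square[symmetric] power_mult_distrib del: of_real_power)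
  finally have "(norm (c *\<^sub>C x))\<^sup>2 = (cmod c * norm x)\<^sup>2"
    using of_real_eq_iff by blast
  then show ?thesis by (rule power2_eq_imp_eq) auto
qed

lemma unimodular_rotation: "\<exists>a. cmod a = 1 \<and> a * z = of_real (cmod z)"
proof (cases "z = 0")
  case True then show ?thesis by (intro exI[of _ 1]) auto
next
  case False
  have "cnj z / cmod z * z = (z * cnj z) / cmod z" by simp
  also have "\<dots> = cmod z" using False
    by (simp add: complex_norm_square[symmetric] power2_eq_square)
  finally show ?thesis using False by (intro exI[of _ "cnj z / cmod z"]) (auto simp: norm_divide)
qed

text \<open>Rotating \<open>x\<close> makes the inner product real and nonnegative, so that the real
  Cauchy-Schwarz inequality applies.\<close>

lemma cmod_cinner_le: "cmod (cinner (x::'a::complex_inner) y) \<le> norm x * norm y"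
proof -
  obtain a where a: "cmod a = 1" "a * cinner x y = of_real (cmod (cinner x y))"
    using unimodular_rotation by blast
  have "cmod (cinner x y) = Re (cinner (a *\<^sub>C x) y)"
    using a by (simp add: cinner_scaleC_left)
  also have "\<dots> \<le> norm (a *\<^sub>C x) * norm y"
    unfolding Re_cinner by (rule norm_cauchy_schwarz)
  finally show ?thesis by (simp add: norm_scaleC a)
qed

lemma bounded_linear_scaleC: "bounded_linear (\<lambda>x::'a::complex_inner. c *\<^sub>C x)"
  by (rule bounded_linear_intro[where K = "cmod c"])
     (auto simp: scaleC_add_right scaleC_scaleR_commute norm_scaleC)

section \<open>Bounded complex-linear maps\<close>

lemma bounded_clinearD:
  assumes "bounded_clinear T"
  shows "bounded_linear T" "T (x + y) = T x + T y" "T (x - y) = T x - T y" "T (- x) = - T x"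
    "T (c *\<^sub>C x) = c *\<^sub>C T x" "T (r *\<^sub>R x) = r *\<^sub>R T x" "T 0 = 0"
proof -
  show 1: "bounded_linear T" using assms by (simp add: bounded_clinear_def)
  interpret T: bounded_linear T by fact
  show "T (x + y) = T x + T y" "T (x - y) = T x - T y" "T (- x) = - T x" "T (r *\<^sub>R x) = r *\<^sub>R T x" "T 0 = 0"
    by (simp_all add: T.add T.diff T.neg T.scaleR T.zero)
  show "T (c *\<^sub>C x) = c *\<^sub>C T x" using assms by (simp add: bounded_clinear_def)
qed

lemma bounded_clinear_intro:
  assumes "\<And>x y. T (x + y) = T x + T y" "\<And>c x. T (c *\<^sub>C x) = c *\<^sub>C T x"
    "\<And>x. norm (T x) \<le> norm x * K"
  shows "bounded_clinear T"
  unfolding bounded_clinear_def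
  using assms by (auto intro!: bounded_linear_intro[where K = K] simp flip: scaleC_of_real)

lemma bounded_clinear_compose:
  "bounded_clinear S \<Longrightarrow> bounded_clinear T \<Longrightarrow> bounded_clinear (\<lambda>x. S (T x))"
  by (auto simp: bounded_clinear_def intro: bounded_linear_compose)

lemma bounded_clinear_add:
  "bounded_clinear S \<Longrightarrow> bounded_clinear T \<Longrightarrow> bounded_clinear (\<lambda>x. S x + T x)"
  by (auto simp: bounded_clinear_def scaleC_add_right intro: bounded_linear_add)

lemma bounded_clinear_diff:
  "bounded_clinear S \<Longrightarrow> bounded_clinear T \<Longrightarrow> bounded_clinear (\<lambda>x. S x - T x)"
  by (auto simp: bounded_clinear_def scaleC_diff_right intro: bounded_linear_sub)

lemma bounded_clinear_scaleC: "bounded_clinear T \<Longrightarrow> bounded_clinear (\<lambda>x. c *\<^sub>C T x)"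
  using bounded_linear_compose[OF bounded_linear_scaleC]
  by (auto simp: bounded_clinear_def scaleC_scaleC mult.commute)

lemma bounded_clinear_scaleR: "bounded_clinear T \<Longrightarrow> bounded_clinear (\<lambda>x. r *\<^sub>R T x)"
  using bounded_clinear_scaleC[of T "of_real r"] by (simp add: scaleC_of_real)

lemma bounded_clinear_ident: "bounded_clinear (\<lambda>x. x)"
  by (simp add: bounded_clinear_def)

lemma bounded_clinear_bound:
  assumes "bounded_clinear T"
  obtains K where "0 < K" "\<And>x. norm (T x) \<le> K * norm x"
  using bounded_linear.pos_bounded[OF bounded_clinearD(1)[OF assms]] by (auto simp: mult.commute)

section \<open>Projections, Riesz representation and adjoints\<close>

lemma quadratic_nonneg_imp_discrim:
  fixes a b c :: real
  assumes "\<And>t. 0 \<le> a + 2 * t * b + t\<^sup>2 * c"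
  shows "b\<^sup>2 \<le> a * c"
proof (cases "c = 0")
  case True
  show ?thesis
  proof (cases "b = 0")
    case False
    \<comment> \<open>At this \<open>t\<close> the affine expression takes the value -1.\<close>
    then show ?thesis using assms[of "- (a + 1) / (2 * b)"] True by (simp add: field_simps)
  qed (use True in simp)
next
  case False
  have "0 \<le> c"
  proof (rule ccontr)
    assume "\<not> 0 \<le> c"
    \<comment> \<open>For \<open>c < 0\<close> this \<open>t\<close> is large enough that
      \<open>t\<^sup>2 * c\<close> outweighs the other two terms.\<close>
    define t where "t = 1 + (\<bar>a\<bar> + 2 * \<bar>b\<bar>) / \<bar>c\<bar>"
    have t: "t \<ge> 1" "t * \<bar>c\<bar> = \<bar>c\<bar> + \<bar>a\<bar> + 2 * \<bar>b\<bar>" using \<open>c \<noteq> 0\<close> by (auto simp: t_def field_simps)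
    have "t\<^sup>2 * c = - t * (t * \<bar>c\<bar>)" using \<open>\<not> 0 \<le> c\<close> by (simp add: power2_eq_square)
    then have e: "t\<^sup>2 * c = - t * (\<bar>c\<bar> + \<bar>a\<bar> + 2 * \<bar>b\<bar>)" using t by simp
    have "a \<le> t * \<bar>a\<bar>" using mult_right_mono[OF t(1), of "\<bar>a\<bar>"] by simp
    moreover have "2 * t * b \<le> t * (2 * \<bar>b\<bar>)" using t by simp
    moreover have "0 < t * \<bar>c\<bar>" using t \<open>c \<noteq> 0\<close> by simp
    ultimately show False using assms[of t] e by (simp add: algebra_simps)
  qed
  then have "0 < c" using False by simp
  then show ?thesis using assms[of "- b / c"] by (simp add: field_simps power2_eq_square)
qed

text \<open>The parallelogram law makes a distance-minimising sequence Cauchy, and moving its limit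
  along a line in \<open>S\<close> cannot decrease the distance, which gives orthogonality.\<close>

lemma projection_exists:
  fixes S :: "'a::{real_inner,banach} set"
  assumes "closed S" "subspace S"
  obtains p where "p \<in> S" "\<And>s. s \<in> S \<Longrightarrow> inner (x - p) s = 0"
proof -
  define D where "D = (INF s\<in>S. (norm (x - s))\<^sup>2)"
  have ne: "S \<noteq> {}" using assms(2) subspace_0 by blast
  have bdd: "bdd_below ((\<lambda>s. (norm (x - s))\<^sup>2) ` S)" by (rule bdd_belowI[of _ 0]) auto
  have lower: "D \<le> (norm (x - s))\<^sup>2" if "s \<in> S" for s
    unfolding D_def by (rule cINF_lower[OF bdd that])
  have "\<exists>s\<in>S. (norm (x - s))\<^sup>2 < D + inverse (real (Suc n))" for n
    using cINF_less_iff[OF ne bdd, of "D + inverse (real (Suc n))"] unfolding D_def by simp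
  then obtain s where s: "\<And>n. s n \<in> S" "\<And>n. (norm (x - s n))\<^sup>2 < D + inverse (real (Suc n))"
    by metis
  have close: "(norm (s n - s m))\<^sup>2 \<le> 2 * inverse (real (Suc n)) + 2 * inverse (real (Suc m))" for n m
  proof -
    \<comment> \<open>The midpoint lies in \<open>S\<close>, so its squared distance to
      \<open>x\<close> is at least \<open>D\<close>.\<close>
    have "(1/2) *\<^sub>R (s n + s m) \<in> S" using s assms(2) by (simp add: subspace_add subspace_scale)
    from lower[OF this] have "4 * D \<le> (norm (2 *\<^sub>R (x - (1/2) *\<^sub>R (s n + s m))))\<^sup>2" by (simp add: power_mult_distrib)
    also have "2 *\<^sub>R (x - (1/2) *\<^sub>R (s n + s m)) = (x - s n) + (x - s m)" by (simp add: algebra_simps scaleR_2)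
    finally have "4 * D \<le> (norm ((x - s n) + (x - s m)))\<^sup>2" .
    moreover have "(norm ((x - s n) + (x - s m)))\<^sup>2 + (norm (s n - s m))\<^sup>2
       = 2 * (norm (x - s n))\<^sup>2 + 2 * (norm (x - s m))\<^sup>2"
      by (simp add: power2_norm_eq_inner inner_simps inner_commute)
    ultimately show ?thesis using s(2)[of n] s(2)[of m] by linarith
  qed
  have "Cauchy s"
  proof (rule metric_CauchyI)
    fix e :: real assume "0 < e"
    then obtain N where N: "inverse (real (Suc N)) < e\<^sup>2 / 4"
      using reals_Archimedean[of "e\<^sup>2 / 4"] by auto
    show "\<exists>M. \<forall>m\<ge>M. \<forall>n\<ge>M. dist (s m) (s n) < e"
    proof (intro exI[of _ N] allI impI)
      fix m n assume "m \<ge> N" "n \<ge> N"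
      then have "inverse (real (Suc m)) \<le> inverse (real (Suc N))" "inverse (real (Suc n)) \<le> inverse (real (Suc N))"
        by (auto simp: field_simps)
      then have "(norm (s m - s n))\<^sup>2 < e\<^sup>2" using close[of m n] N by linarith
      then show "dist (s m) (s n) < e" using \<open>0 < e\<close> by (simp add: dist_norm power2_less_imp_less)
    qed
  qed
  then obtain p where p: "s \<longlonglongrightarrow> p" using Cauchy_convergent_iff convergent_def by blast
  have "p \<in> S" using closed_sequentially[OF assms(1)] s(1) p by blast
  have "(\<lambda>n. (norm (x - s n))\<^sup>2) \<longlonglongrightarrow> (norm (x - p))\<^sup>2" by (intro tendsto_intros p)
  moreover have "(\<lambda>n. D + inverse (real (Suc n))) \<longlonglongrightarrow> D + 0"
    by (intro tendsto_intros LIMSEQ_inverse_real_of_nat)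
  ultimately have le: "(norm (x - p))\<^sup>2 \<le> D"
    using LIMSEQ_le s(2) less_imp_le by (metis (no_types, lifting) add.right_neutral)
  have "inner (x - p) u = 0" if "u \<in> S" for u
  proof -
    have "0 \<le> 0 + 2 * t * inner (x - p) u + t\<^sup>2 * (norm u)\<^sup>2" for t
    proof -
      have "p - t *\<^sub>R u \<in> S" using \<open>p \<in> S\<close> that assms(2) by (simp add: subspace_diff subspace_scale)
      from lower[OF this] le have "(norm (x - p))\<^sup>2 \<le> (norm (x - (p - t *\<^sub>R u)))\<^sup>2" by linarith
      also have "x - (p - t *\<^sub>R u) = (x - p) + t *\<^sub>R u" by simp
      finally have "(norm (x - p))\<^sup>2 \<le> (norm ((x - p) + t *\<^sub>R u))\<^sup>2" .
      moreover have "(norm ((x - p) + t *\<^sub>R u))\<^sup>2 = (norm (x - p))\<^sup>2 + 2 * t * inner (x - p) u + t\<^sup>2 * (norm u)\<^sup>2"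
        unfolding power2_norm_eq_inner
        by (simp add: inner_add_left inner_add_right inner_commute power2_eq_square[of t])
      ultimately show ?thesis by simp
    qed
    \<comment> \<open>The constant term is 0, so the discriminant bound forces the linear
      coefficient to vanish.\<close>
    from quadratic_nonneg_imp_discrim[OF this] show ?thesis by simp
  qed
  with \<open>p \<in> S\<close> show ?thesis using that by blast
qed

text \<open>\<open>S\<close> is stable under \<open>\<i>\<close>, so real orthogonality to all of
  \<open>S\<close> also kills the imaginary parts.\<close>

lemma cprojection_exists:
  fixes S :: "'a::complex_hilbert_space set"
  assumes "closed S" "subspace S" "\<And>c s. s \<in> S \<Longrightarrow> c *\<^sub>C s \<in> S"
  shows "\<exists>p\<in>S. \<forall>s\<in>S. cinner (x - p) s = 0"
proof -
  obtain p where p: "p \<in> S" "\<And>s. s \<in> S \<Longrightarrow> inner (x - p) s = 0"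
    using projection_exists[OF assms(1,2)] by blast
  then have "cinner (x - p) s = 0" if "s \<in> S" for s
    using that assms(3) by (auto simp: complex_eq_iff Re_cinner Im_cinner)
  with p show ?thesis by blast
qed

text \<open>A vector \<open>w\<close> orthogonal to the kernel of \<open>f\<close> represents
  \<open>f\<close> up to a scalar, because subtracting \<open>(f x / f w) *\<^sub>C w\<close> from
  \<open>x\<close> lands in the kernel.\<close>

lemma riesz_representation:
  fixes f :: "'a::complex_hilbert_space \<Rightarrow> complex"
  assumes bl: "bounded_linear f" and sc: "\<And>c x. f (c *\<^sub>C x) = c * f x"
  obtains y where "\<And>x. f x = cinner x y"
proof (cases "\<forall>x. f x = 0")
  case True
  then show ?thesis using that[of 0] by simp
next
  case False
  interpret bounded_linear f by (rule bl)
  from False obtain z where z: "f z \<noteq> 0" by blast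
  let ?N = "{x. f x = 0}"
  have "closed ?N"
    by (intro closed_Collect_eq continuous_intros continuous_on continuous_on_id)
  moreover have "subspace ?N" by (auto simp: subspace_def add scaleR zero)
  moreover have "c *\<^sub>C s \<in> ?N" if "s \<in> ?N" for c s using that by (simp add: sc)
  ultimately have "\<exists>p\<in>?N. \<forall>s\<in>?N. cinner (z - p) s = 0" by (rule cprojection_exists)
  then obtain p where p: "p \<in> ?N" "\<And>s. s \<in> ?N \<Longrightarrow> cinner (z - p) s = 0" by blast
  define w where "w = z - p"
  have fw: "f w \<noteq> 0" using z p by (simp add: w_def diff)
  then have "w \<noteq> 0" by (auto simp: zero)
  have "f x = cinner x ((cnj (f w) / of_real ((norm w)\<^sup>2)) *\<^sub>C w)" for x
  proof -
    have "x - (f x / f w) *\<^sub>C w \<in> ?N" using fw by (simp add: diff sc)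
    from p(2)[OF this] have "cinner (x - (f x / f w) *\<^sub>C w) w = 0"
      unfolding w_def by (metis cinner_commute complex_cnj_zero)
    then have "cinner x w = f x / f w * of_real ((norm w)\<^sup>2)"
      by (simp add: cinner_diff_left cinner_scaleC_left cinner_self)
    then show ?thesis using fw \<open>w \<noteq> 0\<close> by (simp add: cinner_scaleC_right)
  qed
  then show ?thesis using that by blast
qed

lemma cinner_eqI: "(\<And>z. cinner z x = cinner z y) \<Longrightarrow> x = (y::'a::complex_inner)"
  using cinner_self[of "x - y"] by (simp add: cinner_diff_right)

text \<open>\<open>op_adjoint\<close> is a definite description, so its properties need existence,
  which Riesz representation supplies for each \<open>y\<close>, and uniqueness.\<close>

lemma op_adjoint_props:
  assumes T: "bounded_clinear T"
  shows "bounded_clinear (op_adjoint T)"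
    and "cinner (T x) y = cinner x (op_adjoint T y)"
proof -
  have "\<exists>z. \<forall>x. cinner (T x) y = cinner x z" for y
  proof -
    obtain K where K: "\<And>x. norm (T x) \<le> K * norm x" using bounded_clinear_bound[OF T] by metis
    have "bounded_linear (\<lambda>x. cinner (T x) y)"
    proof (rule bounded_linear_intro[where K = "K * norm y"])
      fix x
      have "norm (cinner (T x) y) \<le> norm (T x) * norm y" by (rule cmod_cinner_le)
      also have "\<dots> \<le> K * norm x * norm y" by (intro mult_right_mono K) auto
      finally show "norm (cinner (T x) y) \<le> norm x * (K * norm y)" by (simp add: mult_ac)
    qed (simp_all add: bounded_clinearD(2,6)[OF T] cinner_simps scaleR_conv_of_real)
    then obtain z where "\<And>x. cinner (T x) y = cinner x z"
      by (rule riesz_representation) (simp_all add: bounded_clinearD(5)[OF T] cinner_scaleC_left)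
    then show ?thesis by blast
  qed
  then obtain S where S: "\<And>x y. cinner (T x) y = cinner x (S y)" by metis
  obtain K where K: "0 < K" "\<And>x. norm (T x) \<le> K * norm x" using bounded_clinear_bound[OF T] by metis
  have "bounded_clinear S"
  proof (rule bounded_clinear_intro[where K = K])
    show "S (x + y) = S x + S y" for x y by (rule cinner_eqI) (simp add: cinner_simps flip: S)
    show "S (c *\<^sub>C x) = c *\<^sub>C S x" for c x by (rule cinner_eqI) (simp add: cinner_simps flip: S)
    fix x
    have "(norm (S x))\<^sup>2 = Re (cinner (T (S x)) x)" by (simp add: S cinner_self)
    also have "\<dots> \<le> norm (T (S x)) * norm x" using cmod_cinner_le complex_Re_le_cmod order_trans by blast
    also have "\<dots> \<le> K * norm (S x) * norm x" by (intro mult_right_mono K) auto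
    finally have "norm (S x) * norm (S x) \<le> norm (S x) * (norm x * K)" by (simp add: power2_eq_square mult_ac)
    then show "norm (S x) \<le> norm x * K" using K(1)
      by (cases "S x = 0") auto
  qed
  have "op_adjoint T = S"
    unfolding op_adjoint_def
  proof (rule the_equality)
    fix S' assume "bounded_clinear S' \<and> (\<forall>x y. cinner (T x) y = cinner x (S' y))"
    then have "cinner x (S' y) = cinner x (S y)" for x y using S by metis
    then show "S' = S" by (intro ext cinner_eqI)
  qed (use S \<open>bounded_clinear S\<close> in blast)
  with S \<open>bounded_clinear S\<close> show "bounded_clinear (op_adjoint T)" "cinner (T x) y = cinner x (op_adjoint T y)"
    by auto
qed

section \<open>Positive operators and square roots\<close>

lemma tendsto_cinner:
  fixes f g :: "'b \<Rightarrow> 'a::complex_inner"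
  assumes "(f \<longlongrightarrow> a) F" "(g \<longlongrightarrow> b) F"
  shows "((\<lambda>x. cinner (f x) (g x)) \<longlongrightarrow> cinner a b) F"
  unfolding tendsto_complex_iff Re_cinner Im_cinner
  by (intro conjI tendsto_inner bounded_linear.tendsto[OF bounded_linear_scaleC] assms)

lemma positive_opD:
  assumes "positive_op A"
  shows "bounded_clinear A" "Im (cinner (A x) x) = 0" "0 \<le> inner (A x) x"
  using assms by (auto simp: positive_op_def complex_is_Real_iff simp flip: Re_cinner)

lemma positive_opI:
  assumes "bounded_clinear A" "\<And>x y. cinner (A x) y = cinner x (A y)" "\<And>x. 0 \<le> inner (A x) x"
  shows "positive_op A"
  unfolding positive_op_def using assms
  by (auto simp: Re_cinner Reals_cnj_iff inner_commute simp flip: cinner_commute)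

text \<open>Polarisation: reality of the form at \<open>x + y\<close> matches the imaginary parts,
  and replacing \<open>x\<close> by \<open>\<i> *\<^sub>C x\<close> turns these into real
  parts.\<close>

lemma positive_op_symmetric:
  assumes "positive_op A"
  shows "cinner (A x) y = cinner x (A y)"
proof -
  note A = positive_opD[OF assms] and lin = bounded_clinearD[OF positive_opD(1)[OF assms]]
  have Im: "Im (cinner (A x) y) = Im (cinner x (A y))" for x y
  proof -
    have "Im (cinner (A x) y) + Im (cinner (A y) x) = 0"
      using A(2)[of "x + y"] A(2)[of x] A(2)[of y] by (simp add: lin cinner_simps)
    then show ?thesis using cinner_commute[of x "A y"] by simp
  qed
  have "Re (cinner (A x) y) = Re (cinner x (A y))"
    using Im[of "\<i> *\<^sub>C x" y] by (simp add: lin cinner_simps)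
  with Im show ?thesis by (simp add: complex_eq_iff)
qed

lemma positive_op_inner_symmetric: "positive_op A \<Longrightarrow> inner (A x) y = inner x (A y)"
  by (metis Re_cinner positive_op_symmetric)

lemma positive_op_cauchy_schwarz:
  assumes "positive_op A"
  shows "(inner (A x) y)\<^sup>2 \<le> inner (A x) x * inner (A y) y"
proof (rule quadratic_nonneg_imp_discrim)
  note lin = bounded_clinearD[OF positive_opD(1)[OF assms]]
  fix t
  have "inner (A y) x = inner (A x) y"
    using positive_op_inner_symmetric[OF assms] by (metis inner_commute)
  then show "0 \<le> inner (A x) x + 2 * t * inner (A x) y + t\<^sup>2 * inner (A y) y"
    using positive_opD(3)[OF assms, of "x + t *\<^sub>R y"]
    by (simp add: lin inner_add_left inner_add_right power2_eq_square algebra_simps)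
qed

lemma positive_op_eq_0: "positive_op A \<Longrightarrow> inner (A x) x = 0 \<Longrightarrow> A x = 0"
  using positive_op_cauchy_schwarz[of A x "A x"] by simp

text \<open>Cauchy-Schwarz for the form of \<open>A\<close> at \<open>x\<close> and
  \<open>A x\<close> bounds the fourth power of \<open>norm (A x)\<close> by the product of the
  squares of \<open>norm x\<close> and \<open>norm (A x)\<close>.\<close>

lemma positive_op_contraction:
  assumes "positive_op A" "\<And>x. inner (A x) x \<le> (norm x)\<^sup>2"
  shows "norm (A x) \<le> norm x"
proof -
  have "(inner (A x) (A x))\<^sup>2 \<le> inner (A x) x * inner (A (A x)) (A x)"
    by (rule positive_op_cauchy_schwarz[OF assms(1)])
  also have "\<dots> \<le> (norm x)\<^sup>2 * (norm (A x))\<^sup>2"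
    by (intro mult_mono assms positive_opD) auto
  finally have "(norm (A x))\<^sup>2 * (norm (A x))\<^sup>2 \<le> (norm x)\<^sup>2 * (norm (A x))\<^sup>2"
    by (simp add: power2_norm_eq_inner[symmetric] power2_eq_square)
  then have "A x = 0 \<or> (norm (A x))\<^sup>2 \<le> (norm x)\<^sup>2" 
    unfolding mult_le_cancel_right by auto
  then show ?thesis by (auto simp: power2_le_iff_abs_le)
qed

lemma positive_op_scaleR:
  assumes "positive_op A" "0 \<le> r"
  shows "positive_op (\<lambda>x. r *\<^sub>R A x)"
  using assms positive_opD[OF assms(1)] positive_op_symmetric[OF assms(1)]
  by (intro positive_opI bounded_clinear_scaleR) (auto simp: cinner_simps)

text \<open>
  For a contraction \<open>R\<close> the iterates increase to the solution \<open>Y\<close> of \<open>Y = (R + Y\<^sup>2) / 2\<close>, so that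
  \<open>(1 - Y)\<^sup>2 = 1 - R\<close>; the scalar iterates majorise the increments and give convergence.
\<close>

primrec sqrt_iter :: "('a::real_vector \<Rightarrow> 'a) \<Rightarrow> nat \<Rightarrow> 'a \<Rightarrow> 'a" where
  "sqrt_iter R 0 = (\<lambda>x. 0)"
| "sqrt_iter R (Suc n) = (\<lambda>x. (1/2) *\<^sub>R (R x + sqrt_iter R n (sqrt_iter R n x)))"

primrec scalar_iter :: "nat \<Rightarrow> real" where
  "scalar_iter 0 = 0"
| "scalar_iter (Suc n) = (1 + (scalar_iter n)\<^sup>2) / 2"

lemma scalar_iter_bounds: "0 \<le> scalar_iter n" "scalar_iter n \<le> 1"
proof -
  have "0 \<le> scalar_iter n \<and> scalar_iter n \<le> 1"
  proof (induction n)
    case (Suc n)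
    then have "(scalar_iter n)\<^sup>2 \<le> 1" by (simp add: power_le_one)
    then show ?case by simp
  qed simp
  then show "0 \<le> scalar_iter n" "scalar_iter n \<le> 1" by auto
qed

lemma scalar_iter_mono: "scalar_iter n \<le> scalar_iter (Suc n)"
proof -
  have "0 \<le> (1 - scalar_iter n)\<^sup>2" by simp
  then show ?thesis by (simp add: power2_diff)
qed

context
  fixes R :: "'a::complex_hilbert_space \<Rightarrow> 'a"
  assumes R: "bounded_clinear R" and contr: "\<And>x. norm (R x) \<le> norm x"
    and sym: "\<And>x y. cinner (R x) y = cinner x (R y)"
begin

lemma bounded_clinear_sqrt_iter: "bounded_clinear (sqrt_iter R n)"
proof (induction n)
  case 0
  show ?case by (simp add: bounded_clinear_def)
next
  case (Suc n)
  show ?case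
    unfolding sqrt_iter.simps
    by (rule bounded_clinear_scaleR[OF bounded_clinear_add[OF R bounded_clinear_compose[OF Suc Suc]]])
qed

lemma sqrt_iter_bound: "norm (sqrt_iter R n x) \<le> scalar_iter n * norm x"
proof (induction n arbitrary: x)
  case (Suc n)
  have "norm (R x + sqrt_iter R n (sqrt_iter R n x)) \<le> norm x + scalar_iter n * (scalar_iter n * norm x)"
    by (rule norm_triangle_mono[OF contr order_trans[OF Suc mult_left_mono[OF Suc scalar_iter_bounds(1)]]])
  then have "(1/2) * norm (R x + sqrt_iter R n (sqrt_iter R n x)) \<le> scalar_iter (Suc n) * norm x"
    by (simp add: power2_eq_square algebra_simps)
  then show ?case by simp
qed simp

text \<open>The squares of successive iterates Y and Z differ by (Z - Y) Z + Y (Z - Y). The scalar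
  recursion obeys the same identity, so the majorisation passes to the next step.\<close>

lemma sqrt_iter_increment:
  "norm (sqrt_iter R (Suc n) x - sqrt_iter R n x) \<le> (scalar_iter (Suc n) - scalar_iter n) * norm x"
proof (induction n arbitrary: x)
  case 0
  show ?case using contr by simp
next
  case (Suc n)
  let ?Y = "sqrt_iter R n" and ?Z = "sqrt_iter R (Suc n)"
  let ?y = "scalar_iter n" and ?z = "scalar_iter (Suc n)"
  have step: "sqrt_iter R (Suc k) x = (1/2) *\<^sub>R (R x + sqrt_iter R k (sqrt_iter R k x))" for k by simp
  have "sqrt_iter R (Suc (Suc n)) x - ?Z x
      = (1/2) *\<^sub>R (R x + ?Z (?Z x)) - (1/2) *\<^sub>R (R x + ?Y (?Y x))"
    by (rule arg_cong2[where f = "(-)", OF step step])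
  also have "\<dots> = (1/2) *\<^sub>R ((?Z (?Z x) - ?Y (?Z x)) + ?Y (?Z x - ?Y x))"
    unfolding bounded_clinearD(3)[OF bounded_clinear_sqrt_iter]
    by (simp add: scaleR_diff_right scaleR_add_right del: sqrt_iter.simps)
  also have "norm \<dots> \<le> (1/2) * ((?z - ?y) * (?z * norm x) + ?y * ((?z - ?y) * norm x))"
    unfolding norm_scaleR
  proof (intro mult_mono norm_triangle_mono)
    have "0 \<le> ?z - ?y" using scalar_iter_mono[of n] by linarith
    then show "norm (?Z (?Z x) - ?Y (?Z x)) \<le> (?z - ?y) * (?z * norm x)"
      by (rule order_trans[OF Suc mult_left_mono[OF sqrt_iter_bound]])
    show "norm (?Y (?Z x - ?Y x)) \<le> ?y * ((?z - ?y) * norm x)"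
      by (rule order_trans[OF sqrt_iter_bound mult_left_mono[OF Suc scalar_iter_bounds(1)]])
  qed auto
  also have "\<dots> = ((1 + ?z\<^sup>2) / 2 - (1 + ?y\<^sup>2) / 2) * norm x"
    by (simp add: field_simps power2_eq_square del: scalar_iter.simps)
  also have "\<dots> = (scalar_iter (Suc (Suc n)) - ?z) * norm x"
    by simp
  finally show ?case .
qed

lemma sqrt_iter_diff:
  assumes "n \<le> m"
  shows "norm (sqrt_iter R m x - sqrt_iter R n x) \<le> (scalar_iter m - scalar_iter n) * norm x"
  using assms
proof (induction m rule: dec_induct)
  case (step m)
  have "sqrt_iter R (Suc m) x - sqrt_iter R n x
      = (sqrt_iter R (Suc m) x - sqrt_iter R m x) + (sqrt_iter R m x - sqrt_iter R n x)" by simp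
  also have "norm \<dots> \<le> (scalar_iter (Suc m) - scalar_iter m) * norm x + (scalar_iter m - scalar_iter n) * norm x"
    by (rule norm_triangle_mono[OF sqrt_iter_increment step.IH])
  finally show ?case by (simp add: algebra_simps)
qed simp

text \<open>The scalar iterates increase and stay at most 1, hence are Cauchy, and by
  \<open>sqrt_iter_diff\<close> their differences dominate those of the operator iterates.\<close>

lemma convergent_sqrt_iter: "convergent (\<lambda>n. sqrt_iter R n x)"
proof -
  have "incseq scalar_iter" using scalar_iter_mono by (rule incseq_SucI)
  then have "convergent scalar_iter"
    by (rule incseq_convergent[where B = 1]) (use scalar_iter_bounds(2) in \<open>auto intro: convergentI\<close>)
  then have c: "Cauchy (\<lambda>n. scalar_iter n * norm x)"
    by (rule convergent_Cauchy[OF convergent_mult[OF _ convergent_const]])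
  have "Cauchy (\<lambda>n. sqrt_iter R n x)"
  proof (rule CauchyI')
    fix e :: real assume "0 < e"
    then obtain N where N: "\<And>m n. m \<ge> N \<Longrightarrow> n \<ge> N \<Longrightarrow> norm (scalar_iter m * norm x - scalar_iter n * norm x) < e"
      using CauchyD[OF c \<open>0 < e\<close>] by blast
    show "\<exists>M. \<forall>m\<ge>M. \<forall>n>m. dist (sqrt_iter R m x) (sqrt_iter R n x) < e"
    proof (intro exI[of _ N] allI impI)
      fix m n assume "N \<le> m" "m < n"
      then have "norm (scalar_iter n * norm x - scalar_iter m * norm x) < e" by (intro N) auto
      moreover have "norm (sqrt_iter R n x - sqrt_iter R m x) \<le> (scalar_iter n - scalar_iter m) * norm x"
        using \<open>m < n\<close> by (intro sqrt_iter_diff) auto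
      ultimately have "norm (sqrt_iter R n x - sqrt_iter R m x) < e"
        by (simp add: left_diff_distrib)
      then show "dist (sqrt_iter R m x) (sqrt_iter R n x) < e"
        by (simp add: dist_norm norm_minus_commute)
    qed
  qed
  then show ?thesis by (simp add: Cauchy_convergent_iff)
qed

text \<open>The commutation clause serves the uniqueness of roots: a competing root commutes with
  \<open>R\<close>, hence with a limit built from \<open>R\<close> alone.\<close>

lemma sqrt_one_minus_exists:
  "\<exists>B. positive_op B \<and> (\<forall>x. B (B x) = x - R x) \<and>
     (\<forall>C. bounded_clinear C \<and> (\<forall>x. R (C x) = C (R x)) \<longrightarrow> (\<forall>x. B (C x) = C (B x)))"
proof -
  define Y where "Y x = lim (\<lambda>n. sqrt_iter R n x)" for x
  have Y: "(\<lambda>n. sqrt_iter R n x) \<longlonglongrightarrow> Y x" for x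
    unfolding Y_def using convergent_sqrt_iter convergent_LIMSEQ_iff by blast
  note lin = bounded_clinearD[OF bounded_clinear_sqrt_iter]
  have iter_contr: "norm (sqrt_iter R n x) \<le> norm x" for n x
    using sqrt_iter_bound[of n x] mult_right_mono[OF scalar_iter_bounds(2)[of n], of "norm x"] by simp
  have Y_contr: "norm (Y x) \<le> norm x" for x
    by (rule LIMSEQ_le_const2[OF tendsto_norm[OF Y]]) (use iter_contr in blast)
  have Y_add: "Y (x + y) = Y x + Y y" for x y
    by (rule LIMSEQ_unique[OF Y]) (simp only: lin tendsto_add[OF Y Y])
  have Y_scaleC: "Y (c *\<^sub>C x) = c *\<^sub>C Y x" for c x
    by (rule LIMSEQ_unique[OF Y])
       (simp only: lin bounded_linear.tendsto[OF bounded_linear_scaleC Y])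
  have Y_clin: "bounded_clinear Y"
    using Y_add Y_scaleC Y_contr by (intro bounded_clinear_intro[where K = 1]) auto
  have iter_sym: "cinner (sqrt_iter R n x) y = cinner x (sqrt_iter R n y)" for n x y
    by (induction n arbitrary: x y) (simp_all add: cinner_simps sym)
  have Y_sym: "cinner (Y x) y = cinner x (Y y)" for x y
    by (rule LIMSEQ_unique[OF tendsto_cinner[OF Y tendsto_const]])
       (simp only: iter_sym tendsto_cinner[OF tendsto_const Y])
  \<comment> \<open>Pointwise convergence passes to the composition because all iterates are
    contractions.\<close>
  have YY: "(\<lambda>n. sqrt_iter R n (sqrt_iter R n x)) \<longlonglongrightarrow> Y (Y x)" for x
  proof -
    have "(\<lambda>n. sqrt_iter R n (sqrt_iter R n x - Y x)) \<longlonglongrightarrow> 0"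
    proof (rule Lim_null_comparison)
      show "\<forall>\<^sub>F n in sequentially. norm (sqrt_iter R n (sqrt_iter R n x - Y x)) \<le> norm (sqrt_iter R n x - Y x)"
        using iter_contr by (intro always_eventually) blast
      show "(\<lambda>n. norm (sqrt_iter R n x - Y x)) \<longlonglongrightarrow> 0"
        using Y[of x] by (intro tendsto_norm_zero) (simp add: LIM_zero_iff)
    qed
    from tendsto_add[OF this Y[of "Y x"]] show ?thesis by (simp add: lin)
  qed
  have fixpoint: "Y x = (1/2) *\<^sub>R (R x + Y (Y x))" for x
    by (rule LIMSEQ_unique[OF LIMSEQ_Suc[OF Y]])
       (simp only: sqrt_iter.simps, intro tendsto_intros YY)
  have Y_comm: "Y (C x) = C (Y x)" if C: "bounded_clinear C" "\<And>x. R (C x) = C (R x)" for C x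
  proof -
    have "sqrt_iter R n (C x) = C (sqrt_iter R n x)" for n x
      by (induction n arbitrary: x) (simp_all add: bounded_clinearD[OF C(1)] C(2))
    then have "(\<lambda>n. C (sqrt_iter R n x)) \<longlonglongrightarrow> Y (C x)" using Y[of "C x"] by simp
    moreover have "(\<lambda>n. C (sqrt_iter R n x)) \<longlonglongrightarrow> C (Y x)"
      by (rule bounded_linear.tendsto[OF bounded_clinearD(1)[OF C(1)] Y])
    ultimately show ?thesis by (rule LIMSEQ_unique)
  qed
  show ?thesis
  proof (intro exI[of _ "\<lambda>x. x - Y x"] conjI allI impI)
    have "inner (Y x) x \<le> (norm x)\<^sup>2" for x
    proof -
      have "inner (Y x) x \<le> norm (Y x) * norm x" by (rule norm_cauchy_schwarz)
      also have "\<dots> \<le> norm x * norm x" by (intro mult_right_mono Y_contr) auto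
      finally show ?thesis by (simp add: power2_eq_square)
    qed
    then show "positive_op (\<lambda>x. x - Y x)"
      by (intro positive_opI bounded_clinear_diff bounded_clinear_ident Y_clin)
         (simp_all add: cinner_simps Y_sym inner_diff_left power2_norm_eq_inner)
    show "x - Y x - Y (x - Y x) = x - R x" for x
    proof -
      have "2 *\<^sub>R Y x = 2 *\<^sub>R ((1/2) *\<^sub>R (R x + Y (Y x)))" by (rule arg_cong[OF fixpoint])
      also have "\<dots> = R x + Y (Y x)" by simp
      finally have "2 *\<^sub>R Y x = R x + Y (Y x)" .
      then show ?thesis by (simp add: bounded_clinearD(3)[OF Y_clin] scaleR_2 algebra_simps)
    qed
    show "C x - Y (C x) = C (x - Y x)" if "bounded_clinear C \<and> (\<forall>x. R (C x) = C (R x))" for C x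
      using that Y_comm by (simp add: bounded_clinearD)
  qed
qed

end

text \<open>With \<open>D = B x - C x\<close>, commutation gives \<open>B D + C D = 0\<close>. Two
  nonnegative forms with sum zero vanish, so \<open>B D\<close> and \<open>C D\<close> are 0, and
  symmetry gives \<open>inner D D = 0\<close>.\<close>

lemma positive_sqrt_unique:
  assumes B: "positive_op B" and C: "positive_op C" and sq: "\<And>x. B (B x) = C (C x)"
    and comm: "\<And>x. B (C x) = C (B x)"
  shows "B = C"
proof
  fix x
  note linB = bounded_clinearD[OF positive_opD(1)[OF B]] and linC = bounded_clinearD[OF positive_opD(1)[OF C]]
  define D where "D = B x - C x"
  have "B D + C D = 0" by (simp add: D_def linB linC sq comm)
  then have "inner (B D) D + inner (C D) D = 0" by (simp flip: inner_add_left)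
  with positive_opD(3)[OF B, of D] positive_opD(3)[OF C, of D]
  have "inner (B D) D = 0" "inner (C D) D = 0" by linarith+
  then have "B D = 0" "C D = 0" using positive_op_eq_0 B C by blast+
  moreover have "inner D D = inner (B D) x - inner (C D) x"
    using positive_op_inner_symmetric[OF B, of D x] positive_op_inner_symmetric[OF C, of D x]
    by (simp add: D_def inner_diff_right)
  ultimately have "D = 0" by simp
  then show "B x = C x" by (simp add: D_def)
qed

lemma op_sqrt_props:
  assumes A: "positive_op A"
  shows "positive_op (op_sqrt A)" "op_sqrt A (op_sqrt A x) = A x"
proof -
  note lin = bounded_clinearD[OF positive_opD(1)[OF A]]
  obtain K where K: "0 < K" "\<And>x. norm (A x) \<le> K * norm x"
    using bounded_clinear_bound[OF positive_opD(1)[OF A]] by metis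
  \<comment> \<open>Dividing by the bound \<open>K\<close> makes \<open>R\<close> a positive
    contraction, so that \<open>A / K\<close>, which is \<open>1 - R\<close>, has a root; the factor
    \<open>sqrt K\<close> below undoes the scaling.\<close>
  define R where "R x = x - (1/K) *\<^sub>R A x" for x
  have R: "bounded_clinear R" unfolding R_def
    by (intro bounded_clinear_diff bounded_clinear_ident bounded_clinear_scaleR positive_opD(1) A)
  have Rsym: "cinner (R x) y = cinner x (R y)" for x y
    by (simp add: R_def cinner_simps positive_op_symmetric[OF A])
  have "inner (A x) x \<le> K * (norm x)\<^sup>2" for x
  proof -
    have "inner (A x) x \<le> norm (A x) * norm x" by (rule norm_cauchy_schwarz)
    also have "\<dots> \<le> K * norm x * norm x" by (intro mult_right_mono K) auto
    finally show ?thesis by (simp add: power2_eq_square mult_ac)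
  qed
  then have "positive_op R"
    using K(1) by (intro positive_opI R Rsym) (simp add: R_def inner_diff_left power2_norm_eq_inner field_simps)
  moreover have "inner (R x) x \<le> (norm x)\<^sup>2" for x
    using K(1) positive_opD(3)[OF A, of x] by (simp add: R_def inner_diff_left power2_norm_eq_inner)
  ultimately have "norm (R x) \<le> norm x" for x by (rule positive_op_contraction)
  from sqrt_one_minus_exists[OF R this Rsym] obtain B0 where B0: "positive_op B0 \<and>
    (\<forall>x. B0 (B0 x) = x - R x) \<and>
    (\<forall>C. bounded_clinear C \<and> (\<forall>x. R (C x) = C (R x)) \<longrightarrow> (\<forall>x. B0 (C x) = C (B0 x)))" ..
  note B0 = B0[THEN conjunct1] B0[THEN conjunct2, THEN conjunct1] B0[THEN conjunct2, THEN conjunct2]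
  define B where "B x = sqrt K *\<^sub>R B0 x" for x
  have B: "positive_op B" unfolding B_def using K(1) by (intro positive_op_scaleR B0) auto
  have BB: "B (B x) = A x" for x
    using K(1) by (simp add: B_def bounded_clinearD[OF positive_opD(1)[OF B0(1)]] B0(2) R_def)
  have uniq: "C = B" if C: "positive_op C" "\<And>x. C (C x) = A x" for C
  proof (rule positive_sqrt_unique[OF C(1) B])
    show "C (C x) = B (B x)" for x by (simp add: C BB)
    note linC = bounded_clinearD[OF positive_opD(1)[OF C(1)]]
    \<comment> \<open>Any root \<open>C\<close> commutes with its square \<open>A\<close>, hence
      with \<open>R\<close>.\<close>
    have "R (C x) = C (R x)" for x by (simp add: R_def linC flip: C(2))
    then have "B0 (C x) = C (B0 x)" for x 
      using B0(3) positive_opD(1)[OF C(1)] by blast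
    then show "C (B x) = B (C x)" for x by (simp add: B_def linC)
  qed
  have "op_sqrt A = B"
    unfolding op_sqrt_def
  proof (rule the_equality)
    show "positive_op B \<and> B \<circ> B = A" using B BB by (auto simp: fun_eq_iff)
    fix C assume "positive_op C \<and> C \<circ> C = A"
    then show "C = B" using uniq by (auto simp: fun_eq_iff o_def)
  qed
  then show "positive_op (op_sqrt A)" "op_sqrt A (op_sqrt A x) = A x"
    using B BB by auto
qed

section \<open>Polar decomposition\<close>

lemma positive_op_adjoint_comp:
  assumes "bounded_clinear T"
  shows "positive_op (op_adjoint T \<circ> T)"
proof -
  have *: "cinner (op_adjoint T (T x)) y = cinner (T x) (T y)" for x y
    by (metis cinner_commute op_adjoint_props(2)[OF assms])
  have "0 \<le> inner (op_adjoint T (T x)) x" for x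
    by (simp add: * flip: Re_cinner) (simp add: cinner_self)
  then show ?thesis
    unfolding o_def using bounded_clinear_compose[OF op_adjoint_props(1)[OF assms] assms]
    by (intro positive_opI) (simp_all add: * op_adjoint_props(2)[OF assms])
qed

lemma positive_op_abs: "bounded_clinear T \<Longrightarrow> positive_op (op_abs T)"
  unfolding op_abs_def by (rule op_sqrt_props[OF positive_op_adjoint_comp])

text \<open>This makes the map from \<open>op_abs T x\<close> to \<open>T x\<close> well defined and
  isometric.\<close>

lemma cinner_op_abs:
  assumes "bounded_clinear T"
  shows "cinner (op_abs T x) (op_abs T y) = cinner (T x) (T y)"
proof -
  have "cinner (op_abs T x) (op_abs T y) = cinner x (op_abs T (op_abs T y))"
    by (rule positive_op_symmetric[OF positive_op_abs[OF assms]])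
  also have "op_abs T (op_abs T y) = op_adjoint T (T y)"
    unfolding op_abs_def by (simp add: op_sqrt_props(2)[OF positive_op_adjoint_comp[OF assms]])
  finally show ?thesis by (simp add: op_adjoint_props(2)[OF assms])
qed

lemma norm_op_abs:
  assumes "bounded_clinear T"
  shows "norm (op_abs T x) = norm (T x)"
  using cinner_op_abs[OF assms, of x x] unfolding cinner_self of_real_eq_iff by simp

section \<open>The polar isometry, built from its graph\<close>

context
  fixes T :: "'a::complex_hilbert_space \<Rightarrow> 'a"
  assumes T: "bounded_clinear T"
begin

lemmas op_abs_clinear = bounded_clinearD[OF positive_opD(1)[OF positive_op_abs[OF T]]]

lemma op_abs_eq_0_iff: "op_abs T x = 0 \<longleftrightarrow> T x = 0"
  using norm_op_abs[OF T, of x] by (metis norm_eq_zero)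

text \<open>The closure of the graph of the isometry \<open>|T| x \<mapsto> T x\<close>.\<close>

definition polar_graph :: "'a \<Rightarrow> 'a \<Rightarrow> bool" where
  "polar_graph u v \<longleftrightarrow> (\<exists>X. (\<lambda>n. op_abs T (X n)) \<longlonglongrightarrow> u \<and> (\<lambda>n. T (X n)) \<longlonglongrightarrow> v)"

lemma polar_graph_op_abs: "polar_graph (op_abs T x) (T x)"
  unfolding polar_graph_def by (intro exI[of _ "\<lambda>n. x"]) auto

lemma polar_graph_add:
  assumes "polar_graph u v" "polar_graph u' v'"
  shows "polar_graph (u + u') (v + v')"
proof -
  obtain X X' where "(\<lambda>n. op_abs T (X n)) \<longlonglongrightarrow> u" "(\<lambda>n. T (X n)) \<longlonglongrightarrow> v"
    "(\<lambda>n. op_abs T (X' n)) \<longlonglongrightarrow> u'" "(\<lambda>n. T (X' n)) \<longlonglongrightarrow> v'"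
    using assms unfolding polar_graph_def by blast
  then show ?thesis unfolding polar_graph_def
    by (intro exI[of _ "\<lambda>n. X n + X' n"]) (simp add: op_abs_clinear bounded_clinearD[OF T] tendsto_add)
qed

lemma polar_graph_scaleC:
  assumes "polar_graph u v"
  shows "polar_graph (c *\<^sub>C u) (c *\<^sub>C v)"
proof -
  obtain X where "(\<lambda>n. op_abs T (X n)) \<longlonglongrightarrow> u" "(\<lambda>n. T (X n)) \<longlonglongrightarrow> v"
    using assms unfolding polar_graph_def by blast
  then show ?thesis unfolding polar_graph_def
    by (intro exI[of _ "\<lambda>n. c *\<^sub>C X n"])
       (simp add: op_abs_clinear bounded_clinearD[OF T] bounded_linear.tendsto[OF bounded_linear_scaleC])
qed

lemma polar_graph_diff:
  assumes "polar_graph u v" "polar_graph u' v'"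
  shows "polar_graph (u - u') (v - v')"
  using polar_graph_add[OF assms(1) polar_graph_scaleC[OF assms(2), of "-1"]]
  by (simp add: scaleC_minus_one)

lemma polar_graph_norm:
  assumes "polar_graph u v"
  shows "norm u = norm v"
proof -
  obtain X where X: "(\<lambda>n. op_abs T (X n)) \<longlonglongrightarrow> u" "(\<lambda>n. T (X n)) \<longlonglongrightarrow> v"
    using assms unfolding polar_graph_def by blast
  show ?thesis
    using LIMSEQ_unique[OF tendsto_norm[OF X(1)]] tendsto_norm[OF X(2)] by (simp add: norm_op_abs[OF T])
qed

text \<open>\<open>op_abs T\<close> is self-adjoint, so its kernel is orthogonal to its range and to
  limits of the range.\<close>

lemma polar_graph_orthogonal:
  assumes "polar_graph u v" "op_abs T w = 0"
  shows "cinner w u = 0"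
proof -
  obtain X where X: "(\<lambda>n. op_abs T (X n)) \<longlonglongrightarrow> u"
    using assms unfolding polar_graph_def by blast
  have "cinner w (op_abs T (X n)) = 0" for n
    using positive_op_symmetric[OF positive_op_abs[OF T], of w "X n"] assms(2) by simp
  then show ?thesis
    using LIMSEQ_unique[OF tendsto_cinner[OF tendsto_const X]] by simp
qed

lemma polar_graph_cinner:
  assumes "polar_graph u v"
  shows "cinner (op_abs T z) u = cinner (T z) v"
proof -
  obtain X where X: "(\<lambda>n. op_abs T (X n)) \<longlonglongrightarrow> u" "(\<lambda>n. T (X n)) \<longlonglongrightarrow> v"
    using assms unfolding polar_graph_def by blast
  show ?thesis
    using LIMSEQ_unique[OF tendsto_cinner[OF tendsto_const X(1)]] tendsto_cinner[OF tendsto_const X(2)]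
    by (simp add: cinner_op_abs[OF T])
qed

text \<open>\<open>T\<close> and \<open>op_abs T\<close> give equal norms, so convergence of
  \<open>op_abs T (X n)\<close> makes \<open>T (X n)\<close> Cauchy.\<close>

lemma polar_graph_domain: "{u. \<exists>v. polar_graph u v} = closure (range (op_abs T))"
proof (intro equalityI subsetI)
  fix u assume "u \<in> {u. \<exists>v. polar_graph u v}"
  then obtain X where "(\<lambda>n. op_abs T (X n)) \<longlonglongrightarrow> u" unfolding polar_graph_def by blast
  then show "u \<in> closure (range (op_abs T))"
    unfolding closure_sequential by (intro exI[of _ "\<lambda>n. op_abs T (X n)"]) simp
next
  fix u assume "u \<in> closure (range (op_abs T))"
  then obtain Z where Z: "\<And>n. Z n \<in> range (op_abs T)" "Z \<longlonglongrightarrow> u" unfolding closure_sequential by blast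
  then have "\<forall>n. \<exists>x. Z n = op_abs T x" by blast
  then obtain X where X: "\<And>n. Z n = op_abs T (X n)" by metis
  have "Cauchy Z" using Z(2) LIMSEQ_imp_Cauchy by blast
  then have "Cauchy (\<lambda>n. T (X n))"
    unfolding Cauchy_def X by (simp add: dist_norm norm_op_abs[OF T] flip: op_abs_clinear bounded_clinearD[OF T])
  then obtain v where "(\<lambda>n. T (X n)) \<longlonglongrightarrow> v" using Cauchy_convergent convergent_def by blast
  moreover have "Z = (\<lambda>n. op_abs T (X n))" using X by auto
  with Z(2) have "(\<lambda>n. op_abs T (X n)) \<longlonglongrightarrow> u" by simp
  ultimately show "u \<in> {u. \<exists>v. polar_graph u v}" unfolding polar_graph_def by blast
qed

text \<open>Here \<open>p\<close> is the projection of \<open>x\<close> onto the closure of the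
  range; the remainder is orthogonal to the range of a self-adjoint operator, hence in its
  kernel.\<close>

lemma polar_graph_decomposition: "\<exists>v p. polar_graph p v \<and> op_abs T (x - p) = 0"
proof -
  let ?S = "{u. \<exists>v. polar_graph u v}"
  have "closed ?S" unfolding polar_graph_domain by simp
  moreover have "subspace ?S"
    unfolding subspace_def using polar_graph_op_abs[of 0] polar_graph_add polar_graph_scaleC
    by (auto simp flip: scaleC_of_real simp: op_abs_clinear) blast+
  moreover have "c *\<^sub>C s \<in> ?S" if "s \<in> ?S" for c s using that polar_graph_scaleC by blast
  ultimately have "\<exists>p\<in>?S. \<forall>s\<in>?S. cinner (x - p) s = 0" by (rule cprojection_exists)
  then obtain p where p: "p \<in> ?S" "\<And>s. s \<in> ?S \<Longrightarrow> cinner (x - p) s = 0" by blast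
  have "cinner (op_abs T (x - p)) (op_abs T (x - p)) = cinner (x - p) (op_abs T (op_abs T (x - p)))"
    by (rule positive_op_symmetric[OF positive_op_abs[OF T]])
  also have "\<dots> = 0" using p(2) polar_graph_op_abs by blast
  finally have "op_abs T (x - p) = 0" by (simp add: cinner_self)
  with p show ?thesis by blast
qed

text \<open>The difference \<open>p - q\<close> lies both in the closure of the range and in the
  kernel of \<open>op_abs T\<close>, so it is orthogonal to itself.\<close>

lemma polar_graph_unique:
  assumes "polar_graph p v" "op_abs T (x - p) = 0" "polar_graph q w" "op_abs T (x - q) = 0"
  shows "v = w"
proof -
  have *: "polar_graph (p - q) (v - w)" by (intro polar_graph_diff assms)
  have "op_abs T (p - q) = op_abs T (x - q) - op_abs T (x - p)" unfolding op_abs_clinear(3)[symmetric] by simp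
  then have "op_abs T (p - q) = 0" using assms by simp
  from polar_graph_orthogonal[OF * this] have "p - q = 0" by (simp add: cinner_self)
  with polar_graph_norm[OF *] show ?thesis by simp
qed

text \<open>\<open>U\<close> sends \<open>x\<close> to the graph value at its projection
  \<open>p x\<close>, so it is isometric on the closure of the range of \<open>op_abs T\<close> and
  zero on the kernel. The inner product clause says that the adjoint of \<open>U\<close> times
  \<open>U\<close> fixes that range; the Duggal estimate rests on it.\<close>

lemma polar_exists:
  obtains U where "bounded_clinear U" "\<And>x. norm (U x) \<le> norm x" "\<And>x. U (op_abs T x) = T x"
    "\<And>z x. cinner (U (op_abs T z)) (U x) = cinner (op_abs T z) x" "partial_isometry U"
    "null_space U = null_space T"
    "\<And>V. partial_isometry V \<Longrightarrow> T = V \<circ> op_abs T \<Longrightarrow> null_space V = null_space T \<Longrightarrow> V = U"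
proof -
  have "\<forall>x. \<exists>v p. polar_graph p v \<and> op_abs T (x - p) = 0" using polar_graph_decomposition by blast
  from choice[OF this] obtain U where "\<forall>x. \<exists>p. polar_graph p (U x) \<and> op_abs T (x - p) = 0" ..
  from choice[OF this] obtain p where "\<forall>x. polar_graph (p x) (U x) \<and> op_abs T (x - p x) = 0" ..
  then have p: "\<And>x. polar_graph (p x) (U x)" "\<And>x. op_abs T (x - p x) = 0" by auto
  have U_eq: "U x = v" if "polar_graph q v" "op_abs T (x - q) = 0" for x q v
    by (rule polar_graph_unique[OF p that])
  have orth: "cinner (x - p x) (p x) = 0" for x by (rule polar_graph_orthogonal[OF p])
  have pyth: "(norm x)\<^sup>2 = (norm (p x))\<^sup>2 + (norm (x - p x))\<^sup>2" for x
  proof -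
    have "inner (x - p x) (p x) = 0" using orth[of x] by (simp flip: Re_cinner)
    then show ?thesis by (simp add: power2_norm_eq_inner inner_diff_left inner_diff_right inner_commute)
  qed
  have norm_U: "norm (U x) = norm (p x)" for x using polar_graph_norm[OF p(1)] by simp
  have U_le: "norm (U x) \<le> norm x" for x
    unfolding norm_U by (rule power2_le_imp_le) (simp_all add: pyth[of x])
  have U_clin: "bounded_clinear U"
  proof (rule bounded_clinear_intro[where K = 1])
    show "U (x + y) = U x + U y" for x y
      using op_abs_clinear(2)[of "x - p x" "y - p y"] p(2)
      by (intro U_eq[OF polar_graph_add[OF p(1)[of x] p(1)[of y]]]) (simp add: algebra_simps)
    show "U (c *\<^sub>C x) = c *\<^sub>C U x" for c x
      using op_abs_clinear(5)[of c "x - p x"] p(2)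
      by (intro U_eq[OF polar_graph_scaleC[OF p(1)[of x]]]) (simp add: scaleC_diff_right)
  qed (use U_le in simp)
  have UP: "U (op_abs T x) = T x" for x by (rule U_eq[OF polar_graph_op_abs]) (simp add: op_abs_clinear(7))
  have UU: "cinner (U (op_abs T z)) (U x) = cinner (op_abs T z) x" for z x
  proof -
    have "cinner (x - p x) (op_abs T z) = 0" by (rule polar_graph_orthogonal[OF polar_graph_op_abs p(2)])
    then have "cinner (op_abs T z) (x - p x) = 0" by (metis cinner_commute complex_cnj_zero)
    then show ?thesis using polar_graph_cinner[OF p(1)[of x], of z] by (simp add: UP cinner_diff_right)
  qed
  have null: "null_space U = null_space T"
  proof -
    have "U x = 0 \<longleftrightarrow> T x = 0" for x
    proof
      assume "U x = 0"
      then have "p x = 0" using norm_U[of x] by simp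
      then show "T x = 0" using p(2)[of x] op_abs_eq_0_iff by simp
    next
      assume "T x = 0"
      then show "U x = 0"
        using polar_graph_op_abs[of 0] by (intro U_eq[of 0]) (simp_all add: op_abs_eq_0_iff op_abs_clinear(7) bounded_clinearD(7)[OF T])
    qed
    then show ?thesis by (simp add: null_space_def)
  qed
  have "partial_isometry U"
    unfolding partial_isometry_def
  proof (intro conjI allI impI U_clin)
    fix x assume x: "\<forall>y\<in>null_space U. cinner x y = 0"
    \<comment> \<open>The remainder lies in the null space and is orthogonal to both
      \<open>x\<close> and \<open>p x\<close>, hence it is 0.\<close>
    have "x - p x \<in> null_space U"
      using p(2)[of x] unfolding null by (simp add: op_abs_eq_0_iff null_space_def)
    then have "inner x (x - p x) = 0" "inner (p x) (x - p x) = 0"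
      using x orth[of x] by (simp_all add: inner_commute flip: Re_cinner) (metis Re_cinner inner_commute zero_complex.sel(1))
    then have "inner (x - p x) (x - p x) = 0" by (simp only: inner_diff_left)
    then show "norm (U x) = norm x" by (simp add: norm_U)
  qed
  \<comment> \<open>A competitor agrees with \<open>U\<close> on the range of
    \<open>op_abs T\<close>, by continuity on its closure, and vanishes on the remainder
    \<open>x - p x\<close>.\<close>
  moreover have "V = U" if V: "partial_isometry V" "T = V \<circ> op_abs T" "null_space V = null_space T" for V
  proof
    fix x
    have lin: "bounded_clinear V" using V(1) by (simp add: partial_isometry_def)
    obtain X where X: "(\<lambda>n. op_abs T (X n)) \<longlonglongrightarrow> p x" "(\<lambda>n. T (X n)) \<longlonglongrightarrow> U x"
      using p(1)[of x] unfolding polar_graph_def by blast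
    have "(\<lambda>n. V (op_abs T (X n))) \<longlonglongrightarrow> V (p x)"
      by (rule bounded_linear.tendsto[OF bounded_clinearD(1)[OF lin] X(1)])
    moreover have "V (op_abs T y) = T y" for y using V(2) by (metis comp_apply)
    ultimately have "V (p x) = U x" using X(2) by (simp add: LIMSEQ_unique)
    moreover have "V (x - p x) = 0"
      using V(3) p(2)[of x] op_abs_eq_0_iff[of "x - p x"] by (auto simp: null_space_def set_eq_iff)
    ultimately show "V x = U x" by (simp add: bounded_clinearD(3)[OF lin])
  qed
  ultimately show ?thesis by (rule that[OF U_clin U_le UP UU _ null])
qed

lemma polar_isometry_props:
  shows "bounded_clinear (polar_isometry T)" "norm (polar_isometry T x) \<le> norm x"
    "polar_isometry T (op_abs T x) = T x"
    "cinner (polar_isometry T (op_abs T z)) (polar_isometry T x) = cinner (op_abs T z) x"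
proof -
  obtain U where U: "bounded_clinear U" "\<And>x. norm (U x) \<le> norm x" "\<And>x. U (op_abs T x) = T x"
    "\<And>z x. cinner (U (op_abs T z)) (U x) = cinner (op_abs T z) x" "partial_isometry U"
    "null_space U = null_space T"
    "\<And>V. partial_isometry V \<Longrightarrow> T = V \<circ> op_abs T \<Longrightarrow> null_space V = null_space T \<Longrightarrow> V = U"
    by (rule polar_exists) (rule that)
  have "polar_isometry T = U"
    unfolding polar_isometry_def
  proof (rule the_equality)
    show "partial_isometry U \<and> T = U \<circ> op_abs T \<and> null_space U = null_space T"
      using U(3,5,6) by (simp add: fun_eq_iff)
  qed (use U(7) in blast)
  with U(1-4) show "bounded_clinear (polar_isometry T)" "norm (polar_isometry T x) \<le> norm x"
    "polar_isometry T (op_abs T x) = T x"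
    "cinner (polar_isometry T (op_abs T z)) (polar_isometry T x) = cinner (op_abs T z) x" by simp_all
qed

end

section \<open>Numerical radius and spectral radius\<close>

lemma numerical_radius_leI:
  assumes "0 \<le> m" "\<And>x. norm x = 1 \<Longrightarrow> cmod (cinner (A x) x) \<le> m"
  shows "numerical_radius A \<le> m"
  unfolding numerical_radius_def by (rule cSup_least) (use assms in auto)

lemma numerical_radius_upper:
  assumes A: "bounded_clinear A"
  shows "0 \<le> numerical_radius A" "cmod (cinner (A x) x) \<le> numerical_radius A * (norm x)\<^sup>2"
proof -
  obtain K where K: "0 < K" "\<And>x. norm (A x) \<le> K * norm x" using bounded_clinear_bound[OF A] by metis
  let ?S = "insert 0 {cmod (cinner (A x) x) |x. norm x = 1}"
  have "cmod (cinner (A x) x) \<le> K" if "norm x = 1" for x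
    using cmod_cinner_le[of "A x" x] K(2)[of x] that by simp
  then have bdd: "bdd_above ?S" using K(1) by (intro bdd_aboveI[of _ K]) auto
  show "0 \<le> numerical_radius A"
    unfolding numerical_radius_def by (rule cSup_upper[OF _ bdd]) simp
  have unit: "cmod (cinner (A x) x) \<le> numerical_radius A" if "norm x = 1" for x
    unfolding numerical_radius_def by (rule cSup_upper[OF _ bdd]) (use that in blast)
  show "cmod (cinner (A x) x) \<le> numerical_radius A * (norm x)\<^sup>2"
  proof (cases "x = 0")
    case False
    have "cmod (cinner (A (x /\<^sub>R norm x)) (x /\<^sub>R norm x)) \<le> numerical_radius A"
      by (rule unit) (use False in simp)
    then show ?thesis using False
      by (simp add: bounded_clinearD[OF A] cinner_simps norm_mult norm_divide field_simps power2_eq_square)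
  qed simp
qed

text \<open>Coercivity bounds \<open>E\<close> from below, which gives injectivity and a closed
  range. A remainder \<open>x - p\<close> orthogonal to the range has
  \<open>cinner (E (x - p)) (x - p) = 0\<close> and so vanishes.\<close>

lemma lax_milgram:
  fixes E :: "'a::complex_hilbert_space \<Rightarrow> 'a"
  assumes E: "bounded_clinear E" and "0 < d" and coercive: "\<And>x. d * (norm x)\<^sup>2 \<le> cmod (cinner (E x) x)"
  obtains S where "bounded_clinear S" "\<And>x. S (E x) = x" "\<And>x. E (S x) = x"
proof -
  note lin = bounded_clinearD[OF E]
  have below: "d * norm x \<le> norm (E x)" for x
  proof (cases "x = 0")
    case False
    have "d * norm x * norm x \<le> norm (E x) * norm x"
      using coercive[of x] cmod_cinner_le[of "E x" x] by (simp add: power2_eq_square)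
    then show ?thesis using False by simp
  qed simp
  have inj: "x = y" if "E x = E y" for x y
    using below[of "x - y"] that \<open>0 < d\<close> by (simp add: lin mult_le_0_iff)
  have "complete (range E)"
    by (rule complete_isometric_image[OF \<open>0 < d\<close> _ lin(1)]) (use below in \<open>auto simp: complete_UNIV mult.commute\<close>)
  then have "closed (range E)" by (rule complete_imp_closed)
  moreover have "subspace (range E)"
    by (rule linear_subspace_image[OF bounded_linear.linear[OF lin(1)] subspace_UNIV])
  moreover have "c *\<^sub>C s \<in> range E" if "s \<in> range E" for c s
    using that by (auto simp flip: lin(5))
  ultimately have proj: "\<exists>p\<in>range E. \<forall>s\<in>range E. cinner (x - p) s = 0" for x
    by (rule cprojection_exists)
  have range: "x \<in> range E" for x
  proof -
    obtain p where p: "p \<in> range E" "\<And>s. s \<in> range E \<Longrightarrow> cinner (x - p) s = 0"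
      using proj[of x] by blast
    then have "cinner (x - p) (E (x - p)) = 0" by blast
    then have "cinner (E (x - p)) (x - p) = 0" by (metis cinner_commute complex_cnj_zero)
    then have "x = p" using coercive[of "x - p"] \<open>0 < d\<close> by (simp add: mult_le_0_iff)
    with p show ?thesis by simp
  qed
  define S where "S = inv E"
  have ES: "E (S x) = x" for x unfolding S_def by (rule f_inv_into_f[OF range])
  have SE: "S (E x) = x" for x by (rule inj[OF ES])
  have "bounded_clinear S"
  proof (rule bounded_clinear_intro[where K = "1 / d"])
    show "S (x + y) = S x + S y" for x y by (rule inj) (simp add: lin ES)
    show "S (c *\<^sub>C x) = c *\<^sub>C S x" for c x by (rule inj) (simp add: lin ES)
    show "norm (S x) \<le> norm x * (1 / d)" for x
      using below[of "S x"] \<open>0 < d\<close> by (simp add: ES field_simps)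
  qed
  from that[OF this SE ES] show ?thesis .
qed

text \<open>
  If \<open>S\<close> inverts \<open>CB - z\<close>, then \<open>(BSC - 1) / z\<close> inverts \<open>BC - z\<close>.
\<close>

lemma spectral_radius_le_numerical_radius_swap:
  fixes B C :: "'a::complex_hilbert_space \<Rightarrow> 'a"
  assumes B: "bounded_clinear B" and C: "bounded_clinear C"
  shows "spectral_radius (\<lambda>x. B (C x)) \<le> numerical_radius (\<lambda>x. C (B x))"
proof -
  let ?w = "numerical_radius (\<lambda>x. C (B x))"
  note linB = bounded_clinearD[OF B] and linC = bounded_clinearD[OF C]
  have CB: "bounded_clinear (\<lambda>x. C (B x))" by (rule bounded_clinear_compose[OF C B])
  note w = numerical_radius_upper[OF CB]
  have "cmod z \<le> ?w" if "z \<in> op_spectrum (\<lambda>x. B (C x))" for z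
  proof (rule ccontr)
    assume "\<not> cmod z \<le> ?w"
    then have z: "?w < cmod z" "z \<noteq> 0" using w(1) by auto
    let ?E = "\<lambda>x. C (B x) - z *\<^sub>C x"
    have E: "bounded_clinear ?E"
      by (intro bounded_clinear_diff CB bounded_clinear_scaleC bounded_clinear_ident)
    \<comment> \<open>Outside the disc of radius \<open>?w\<close> the triangle inequality makes
      \<open>?E\<close> coercive.\<close>
    have "(cmod z - ?w) * (norm x)\<^sup>2 \<le> cmod (cinner (?E x) x)" for x
    proof -
      have "cmod (z * cinner x x) \<le> cmod (cinner (C (B x)) x) + cmod (cinner (?E x) x)"
        using norm_triangle_ineq4[of "cinner (C (B x)) x" "cinner (?E x) x"] by (simp add: cinner_simps)
      moreover have "cmod (z * cinner x x) = cmod z * (norm x)\<^sup>2" 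
        by (simp add: cinner_self norm_mult del: of_real_power)
      ultimately show ?thesis using w(2)[of x] by (simp add: left_diff_distrib)
    qed
    with z obtain S where S: "bounded_clinear S" "\<And>x. S (?E x) = x" "\<And>x. ?E (S x) = x"
      by (rule_tac lax_milgram[OF E, of "cmod z - ?w"]) auto
    note linS = bounded_clinearD[OF S(1)]
    define R where "R x = (1/z) *\<^sub>C (B (S (C x)) - x)" for x
    have CBS: "C (B (S x)) = x + z *\<^sub>C S x" for x using S(3)[of x] by (simp add: algebra_simps)
    have SCB: "S (C (B x)) = x + z *\<^sub>C S x" for x using S(2)[of x] by (simp add: linS algebra_simps)
    have "bounded_clinear R"
      unfolding R_def
      by (intro bounded_clinear_scaleC bounded_clinear_diff bounded_clinear_ident
          bounded_clinear_compose[OF B] bounded_clinear_compose[OF S(1)] C)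
    moreover have "R (B (C x) - z *\<^sub>C x) = x" for x
      using z(2) by (simp add: R_def linB linC linS SCB scaleC_diff_right scaleC_add_right scaleC_scaleC)
    moreover have "B (C (R x)) - z *\<^sub>C R x = x" for x
      using z(2) by (simp add: R_def linB linC linS CBS scaleC_diff_right scaleC_add_right scaleC_scaleC)
    ultimately show False using that unfolding op_spectrum_def by blast
  qed
  then show ?thesis
    unfolding spectral_radius_def by (intro cSup_least) (use w(1) in auto)
qed

section \<open>The weighted mean and the truncated shift\<close>

text \<open>The summands are powers of a \<open>K\<close>-th root of unity \<open>w\<close>, and
  their geometric sum vanishes unless \<open>w = 1\<close>.\<close>

lemma roots_of_unity_orthogonal:
  fixes K :: nat
  assumes "a < K" "b < K"
  shows "(\<Sum>j<K. cis (2 * pi * real j / real K) ^ a * cnj (cis (2 * pi * real j / real K)) ^ b)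
    = (if a = b then of_nat K else 0)"
proof -
  define w where "w = cis (2 * pi * (real a - real b) / real K)"
  have "0 < K" using assms by simp
  have "cis (2 * pi * real j / real K) ^ a * cnj (cis (2 * pi * real j / real K)) ^ b = w ^ j" for j
    unfolding w_def cis_cnj Complex.DeMoivre cis_mult
    by (rule arg_cong[where f = cis]) (use \<open>0 < K\<close> in \<open>simp add: field_simps\<close>)
  then have sum: "(\<Sum>j<K. cis (2 * pi * real j / real K) ^ a * cnj (cis (2 * pi * real j / real K)) ^ b)
      = (\<Sum>j<K. w ^ j)" by simp
  show ?thesis
  proof (cases "a = b")
    case True
    then have "w = 1" by (simp add: w_def)
    then show ?thesis unfolding sum using True by simp
  next
    case False
    have "w \<noteq> 1"
    proof
      assume "w = 1"
      then have "cos (2 * pi * (real a - real b) / real K) = 1" by (simp add: w_def complex_eq_iff)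
      then obtain n :: int where "2 * pi * (real a - real b) / real K = of_int n * 2 * pi"
        unfolding cos_one_2pi_int by blast
      then have "2 * pi * ((real a - real b) / real K) = 2 * pi * of_int n" by (simp add: mult_ac)
      then have "(real a - real b) / real K = of_int n"
        by (subst (asm) mult_cancel_left) (simp add: pi_neq_zero)
      then have "real a - real b = of_int n * real K" using \<open>0 < K\<close> by (simp add: field_simps)
      then have eq: "int a - int b = n * int K"
        by (metis of_int_diff of_int_eq_iff of_int_mult of_int_of_nat_eq)
      \<comment> \<open>A multiple of \<open>K\<close> of absolute value below \<open>K\<close> is
        0.\<close>
      have "\<bar>int a - int b\<bar> < int K" using assms by linarith
      then have "\<bar>n\<bar> * int K < 1 * int K" unfolding eq by (simp add: abs_mult)
      then have "n = 0" using \<open>0 < K\<close> by (simp only: mult_less_cancel_right) auto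
      with eq False show False by simp
    qed
    moreover have "w ^ K = 1"
    proof -
      have "w ^ K = cis (2 * pi * of_int (int a - int b))"
        unfolding w_def Complex.DeMoivre
        by (rule arg_cong[where f = cis]) (use \<open>0 < K\<close> in simp)
      then show ?thesis by (simp only: cis_multiple_2pi Ints_of_int)
    qed
    ultimately show ?thesis unfolding sum using False by (simp add: geometric_sum)
  qed
qed

text \<open>
  With \<open>V\<close> the truncated shift, \<open>\<omega>(M \<otimes> V) \<le> \<omega>(M)\<close>: average over the rotations \<open>y\<^sub>n \<mapsto> \<zeta>\<^sup>n y\<^sub>n\<close>.
\<close>

lemma numerical_radius_chain:
  assumes M: "bounded_clinear M"
  shows "cmod (\<Sum>n<N. cinner (M (y n)) (y (Suc n))) \<le> numerical_radius M * (\<Sum>n\<le>N. (norm (y n))\<^sup>2)"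
proof -
  \<comment> \<open>The exponents \<open>i + n\<close> reach \<open>N + 1\<close>, and orthogonality
    asks for exponents below \<open>K\<close>.\<close>
  define K where "K = N + 2"
  define e where "e j = cis (2 * pi * real j / real K)" for j
  define z where "z j = (\<Sum>n\<le>N. e j ^ n *\<^sub>C y n)" for j
  have orth: "(\<Sum>j<K. e j ^ a * cnj (e j) ^ b) = (if a = b then of_nat K else 0)" if "a < K" "b < K" for a b
    unfolding e_def by (rule roots_of_unity_orthogonal[OF that])
  \<comment> \<open>The case \<open>i = 0\<close> recovers the norms and \<open>i = 1\<close> the
    shifted products: averaging against \<open>e j ^ i\<close> selects the pairs with
    \<open>k = i + n\<close>.\<close>
  have expand: "(\<Sum>j<K. e j ^ i * cinner (B (z j)) (z j))
      = of_nat K * (\<Sum>n\<le>N. \<Sum>k\<le>N. if i + n = k then cinner (B (y n)) (y k) else 0)"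
    if B: "bounded_clinear B" and i: "i \<le> 1" for B i
  proof -
    note lin = bounded_clinearD[OF B]
    have sumB: "B (\<Sum>n\<in>I. f n) = (\<Sum>n\<in>I. B (f n))" for I :: "nat set" and f
      by (rule linear_sum[OF bounded_linear.linear[OF lin(1)]])
    have "(\<Sum>j<K. e j ^ i * cinner (B (z j)) (z j))
        = (\<Sum>j<K. \<Sum>n\<le>N. \<Sum>k\<le>N. e j ^ (i + n) * cnj (e j) ^ k * cinner (B (y n)) (y k))"
      unfolding z_def sumB lin(5) cinner_sum_left
      unfolding cinner_sum_right cinner_scaleC_left cinner_scaleC_right
      by (simp add: sum_distrib_left power_add mult_ac)
    also have "\<dots> = (\<Sum>n\<le>N. \<Sum>j<K. \<Sum>k\<le>N. e j ^ (i + n) * cnj (e j) ^ k * cinner (B (y n)) (y k))"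
      by (rule sum.swap)
    also have "\<dots> = (\<Sum>n\<le>N. \<Sum>k\<le>N. \<Sum>j<K. e j ^ (i + n) * cnj (e j) ^ k * cinner (B (y n)) (y k))"
      by (intro sum.cong refl sum.swap)
    also have "\<dots> = (\<Sum>n\<le>N. \<Sum>k\<le>N. of_nat K * (if i + n = k then cinner (B (y n)) (y k) else 0))"
    proof (intro sum.cong refl)
      fix n k assume "n \<in> {..N}" "k \<in> {..N}"
      then have "i + n < K" "k < K" using i by (auto simp: K_def)
      from orth[OF this] show "(\<Sum>j<K. e j ^ (i + n) * cnj (e j) ^ k * cinner (B (y n)) (y k))
          = of_nat K * (if i + n = k then cinner (B (y n)) (y k) else 0)"
        unfolding sum_distrib_right[symmetric] by simp
    qed
    finally show ?thesis by (simp only: sum_distrib_left)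
  qed
  have diag: "(\<Sum>j<K. (norm (z j))\<^sup>2) = real K * (\<Sum>n\<le>N. (norm (y n))\<^sup>2)"
  proof -
    have "complex_of_real (\<Sum>j<K. (norm (z j))\<^sup>2) = (\<Sum>j<K. e j ^ 0 * cinner (z j) (z j))"
      by (simp add: cinner_self)
    also have "\<dots> = of_nat K * (\<Sum>n\<le>N. cinner (y n) (y n))"
      by (subst expand[OF bounded_clinear_ident]) simp_all
    also have "\<dots> = complex_of_real (real K * (\<Sum>n\<le>N. (norm (y n))\<^sup>2))" by (simp add: cinner_self)
    finally show ?thesis using of_real_eq_iff by blast
  qed
  \<comment> \<open>The bound \<open>k \<le> N\<close> discards the successor of
    \<open>n = N\<close>: this is the truncation of the shift.\<close>
  have "(\<Sum>n\<le>N. \<Sum>k\<le>N. if 1 + n = k then cinner (M (y n)) (y k) else 0)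
      = (\<Sum>n\<le>N. if n < N then cinner (M (y n)) (y (Suc n)) else 0)"
    by (intro sum.cong refl) (auto simp: sum.delta)
  also have "\<dots> = (\<Sum>n<N. cinner (M (y n)) (y (Suc n)))"
    by (simp flip: lessThan_Suc_atMost)
  finally have off: "(\<Sum>j<K. e j ^ 1 * cinner (M (z j)) (z j))
      = of_nat K * (\<Sum>n<N. cinner (M (y n)) (y (Suc n)))"
    by (subst expand[OF M]) simp_all
  have "real K * cmod (\<Sum>n<N. cinner (M (y n)) (y (Suc n))) = cmod (\<Sum>j<K. e j ^ 1 * cinner (M (z j)) (z j))"
    unfolding off by (simp add: norm_mult del: of_nat_sum)
  also have "\<dots> \<le> (\<Sum>j<K. cmod (e j ^ 1 * cinner (M (z j)) (z j)))" by (rule norm_sum)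
  also have "\<dots> \<le> (\<Sum>j<K. numerical_radius M * (norm (z j))\<^sup>2)"
    by (intro sum_mono) (simp add: norm_mult e_def numerical_radius_upper(2)[OF M])
  also have "\<dots> = real K * (numerical_radius M * (\<Sum>n\<le>N. (norm (y n))\<^sup>2))"
    by (simp add: diag mult_ac flip: sum_distrib_left)
  finally show ?thesis by (simp add: K_def)
qed

text \<open>The inner product on the direct sum of \<open>N + 1\<close> copies of the space, that
  is, on its tensor product with the space where the truncated shift acts. Vectors are sequences
  whose entries beyond \<open>N\<close> are ignored.\<close>

definition chain_inner :: "nat \<Rightarrow> (nat \<Rightarrow> 'a::real_inner) \<Rightarrow> (nat \<Rightarrow> 'a) \<Rightarrow> real" where
  "chain_inner N x y = (\<Sum>n\<le>N. inner (x n) (y n))"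

text \<open>The real part of the form of \<open>W \<otimes> V\<close>.\<close>

definition chain_form :: "('a::real_inner \<Rightarrow> 'a) \<Rightarrow> nat \<Rightarrow> (nat \<Rightarrow> 'a) \<Rightarrow> (nat \<Rightarrow> 'a) \<Rightarrow> real" where
  "chain_form W N x y = (\<Sum>n<N. inner (W (x n)) (y (Suc n)) + inner (W (y n)) (x (Suc n))) / 2"

lemma chain_inner_nonneg: "0 \<le> chain_inner N x x"
  by (simp add: chain_inner_def sum_nonneg)

section \<open>Quadratic forms on chains\<close>

lemma chain_form_self: "chain_form W N x x = (\<Sum>n<N. inner (W (x n)) (x (Suc n)))"
  unfolding chain_form_def sum_divide_distrib by simp

lemma chain_inner_line:
  "chain_inner N (\<lambda>n. x n + t *\<^sub>R y n) (\<lambda>n. x n + t *\<^sub>R y n)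
    = chain_inner N x x + 2 * t * chain_inner N x y + t\<^sup>2 * chain_inner N y y"
  unfolding chain_inner_def sum_distrib_left sum.distrib[symmetric]
  by (intro sum.cong refl) (simp add: inner_add_left inner_add_right inner_commute power2_eq_square algebra_simps)

lemma chain_form_line:
  assumes "linear W"
  shows "chain_form W N (\<lambda>n. x n + t *\<^sub>R y n) (\<lambda>n. x n + t *\<^sub>R y n)
    = chain_form W N x x + 2 * t * chain_form W N x y + t\<^sup>2 * chain_form W N y y"
  unfolding chain_form_self unfolding chain_form_def
  by (simp add: linear_add[OF assms] linear_scale[OF assms] inner_add_left inner_add_right sum.distrib
      sum_distrib_left power2_eq_square algebra_simps)

text \<open>By \<open>bound\<close>, \<open>s\<close> times \<open>chain_inner\<close> minus
  \<open>chain_form\<close> is a nonnegative quadratic form; its values along a line give the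
  discriminant inequality.\<close>

lemma chain_form_cauchy_schwarz:
  assumes "linear W" and bound: "\<And>x. chain_form W N x x \<le> s * chain_inner N x x"
  shows "(s * chain_inner N x y - chain_form W N x y)\<^sup>2
    \<le> (s * chain_inner N x x - chain_form W N x x) * (s * chain_inner N y y - chain_form W N y y)"
proof (rule quadratic_nonneg_imp_discrim)
  fix t
  show "0 \<le> s * chain_inner N x x - chain_form W N x x + 2 * t * (s * chain_inner N x y - chain_form W N x y)
      + t\<^sup>2 * (s * chain_inner N y y - chain_form W N y y)"
    using bound[of "\<lambda>n. x n + t *\<^sub>R y n"]
    unfolding chain_inner_line chain_form_line[OF assms(1)] by (simp add: algebra_simps)
qed

text \<open>Each product is at most the mean of its two squares, and each square occurs in at most
  two products. Hence the truncated shift adds no constant to form bounds.\<close>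

lemma sum_consecutive_products_le:
  fixes a :: "nat \<Rightarrow> real"
  shows "(\<Sum>n<N. a n * a (Suc n)) \<le> (\<Sum>n\<le>N. (a n)\<^sup>2)"
proof -
  have "(\<Sum>n<N. a n * a (Suc n)) \<le> (\<Sum>n<N. ((a n)\<^sup>2 + (a (Suc n))\<^sup>2) / 2)"
  proof (rule sum_mono)
    fix n
    have "0 \<le> (a n - a (Suc n))\<^sup>2" by simp
    then show "a n * a (Suc n) \<le> ((a n)\<^sup>2 + (a (Suc n))\<^sup>2) / 2" by (simp add: power2_diff)
  qed
  also have "\<dots> = ((\<Sum>n<N. (a n)\<^sup>2) + (\<Sum>n<N. (a (Suc n))\<^sup>2)) / 2"
    by (simp add: sum.distrib sum_divide_distrib add_divide_distrib)
  also have "(\<Sum>n<N. (a n)\<^sup>2) \<le> (\<Sum>n\<le>N. (a n)\<^sup>2)" by (rule sum_mono2) auto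
  also have "(\<Sum>n<N. (a (Suc n))\<^sup>2) \<le> (\<Sum>n\<le>N. (a n)\<^sup>2)"
    unfolding lessThan_Suc_atMost[symmetric] sum.lessThan_Suc_shift by simp
  finally show ?thesis by simp
qed

lemma chain_form_bound:
  assumes "0 \<le> k" "\<And>x. norm (X x) \<le> k * norm x"
  shows "(\<Sum>n<N. inner (X (u n)) (u (Suc n))) \<le> k * (\<Sum>n\<le>N. (norm (u n))\<^sup>2)"
proof -
  have "(\<Sum>n<N. inner (X (u n)) (u (Suc n))) \<le> (\<Sum>n<N. k * (norm (u n) * norm (u (Suc n))))"
  proof (rule sum_mono)
    fix n
    have "inner (X (u n)) (u (Suc n)) \<le> norm (X (u n)) * norm (u (Suc n))" by (rule norm_cauchy_schwarz)
    also have "\<dots> \<le> k * norm (u n) * norm (u (Suc n))" by (intro mult_right_mono assms) auto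
    finally show "inner (X (u n)) (u (Suc n)) \<le> k * (norm (u n) * norm (u (Suc n)))" by (simp add: mult_ac)
  qed
  also have "\<dots> \<le> k * (\<Sum>n\<le>N. (norm (u n))\<^sup>2)"
    unfolding sum_distrib_left[symmetric]
    by (intro mult_left_mono sum_consecutive_products_le assms)
  finally show ?thesis .
qed

section \<open>From the weighted mean to the form of \<open>A X A\<close>\<close>

lemma le_zero_if_le_small_multiples:
  fixes a b d :: real
  assumes "0 < d" "\<And>e. 0 < e \<Longrightarrow> e < d \<Longrightarrow> a \<le> e * b"
  shows "a \<le> 0"
proof (rule tendsto_lowerbound)
  show "((\<lambda>e. e * b) \<longlongrightarrow> 0) (at_right 0)"
    by (auto intro!: tendsto_eq_intros)
  show "\<forall>\<^sub>F e in at_right 0. a \<le> e * b"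
    using eventually_at_right_less eventually_at_right_field assms
    by (metis (mono_tags, lifting))
qed simp

lemma bounded_clinear_weighted:
  assumes A: "bounded_clinear A" and X: "bounded_clinear X"
  shows "bounded_clinear (\<lambda>x. p *\<^sub>R X (A (A x)) + q *\<^sub>R A (A (X x)))"
  by (intro bounded_clinear_add bounded_clinear_scaleR bounded_clinear_compose[OF X]
      bounded_clinear_compose[OF A] A X)

text \<open>With \<open>B = A \<otimes> diag(c^n)\<close>, the real form of
  \<open>M \<otimes> V\<close> at \<open>B x\<close> is \<open>2 * r\<close> times the form of
  \<open>A X A \<otimes> V\<close> at \<open>x\<close> and \<open>B^2 x\<close>: the two terms of
  \<open>M\<close> acquire the weights \<open>r * c ^ (2 * n)\<close> and
  \<open>r * c ^ (2 * Suc n)\<close>, and \<open>A\<close> moves across the inner product.\<close>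

lemma chain_form_weighted:
  fixes A X :: "'a::complex_hilbert_space \<Rightarrow> 'a"
  assumes A: "positive_op A" and X: "bounded_clinear X" and "0 < c" "0 < r"
  defines "M \<equiv> \<lambda>x. (r / c) *\<^sub>R X (A (A x)) + (r * c) *\<^sub>R A (A (X x))"
  shows "2 * r * chain_form (\<lambda>x. A (X (A x))) N x (\<lambda>n. c ^ (2 * n) *\<^sub>R A (A (x n)))
    \<le> numerical_radius M * (\<Sum>n\<le>N. c ^ (2 * n) * (norm (A (x n)))\<^sup>2)"
proof -
  note linA = bounded_clinearD[OF positive_opD(1)[OF A]] and linX = bounded_clinearD[OF X]
  note symA = positive_op_inner_symmetric[OF A]
  have M: "bounded_clinear M"
    unfolding M_def by (rule bounded_clinear_weighted[OF positive_opD(1)[OF A] X])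
  define y where "y n = c ^ n *\<^sub>R A (x n)" for n
  have "inner (M (y n)) (y (Suc n)) = r * (inner (A (X (A (c ^ (2 * n) *\<^sub>R A (A (x n)))))) (x (Suc n))
      + inner (A (X (A (x n)))) (c ^ (2 * Suc n) *\<^sub>R A (A (x (Suc n)))))" for n
  proof -
    have "inner (M (y n)) (y (Suc n)) = (r / c) * (c ^ n * c ^ Suc n) * inner (X (A (A (A (x n))))) (A (x (Suc n)))
        + (r * c) * (c ^ n * c ^ Suc n) * inner (A (A (X (A (x n))))) (A (x (Suc n)))"
      by (simp add: M_def y_def linA linX inner_add_left mult_ac distrib_left)
    also have "(r / c) * (c ^ n * c ^ Suc n) = r * c ^ (2 * n)"
      using \<open>0 < c\<close> by (simp add: mult_2 power_add)
    also have "(r * c) * (c ^ n * c ^ Suc n) = r * c ^ (2 * Suc n)"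
      by (simp add: mult_2 power_add)
    finally show ?thesis by (simp add: linA linX symA algebra_simps del: power_Suc)
  qed
  then have "(\<Sum>n<N. inner (M (y n)) (y (Suc n)))
      = 2 * r * chain_form (\<lambda>x. A (X (A x))) N x (\<lambda>n. c ^ (2 * n) *\<^sub>R A (A (x n)))"
    unfolding chain_form_def by (simp add: add.commute flip: sum_distrib_left)
  then have "2 * r * chain_form (\<lambda>x. A (X (A x))) N x (\<lambda>n. c ^ (2 * n) *\<^sub>R A (A (x n)))
      = (\<Sum>n<N. inner (M (y n)) (y (Suc n)))" ..
  also have "\<dots> = Re (\<Sum>n<N. cinner (M (y n)) (y (Suc n)))" by (simp add: Re_cinner)
  also have "\<dots> \<le> cmod (\<Sum>n<N. cinner (M (y n)) (y (Suc n)))" by (rule complex_Re_le_cmod)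
  also have "\<dots> \<le> numerical_radius M * (\<Sum>n\<le>N. (norm (y n))\<^sup>2)" by (rule numerical_radius_chain[OF M])
  also have "(\<Sum>n\<le>N. (norm (y n))\<^sup>2) = (\<Sum>n\<le>N. c ^ (2 * n) * (norm (A (x n)))\<^sup>2)"
    using \<open>0 < c\<close> by (simp add: y_def power_mult_distrib power_mult mult.commute[of 2])
  finally show ?thesis .
qed

text \<open>
  The supremum \<open>s\<close> of the form of \<open>W \<otimes> V\<close> need not be attained. A vector \<open>x\<close> at which it is almost
  attained is almost an eigenvector by the Cauchy--Schwarz inequality for \<open>s - W \<otimes> V\<close>, so that the
  form at \<open>x\<close> and \<open>v\<close> is close to \<open>s\<close> times the inner product of \<open>x\<close> and \<open>v\<close>.
\<close>

lemma chain_form_le: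
  fixes A X :: "'a::complex_hilbert_space \<Rightarrow> 'a"
  assumes A: "positive_op A" and X: "bounded_clinear X" and "0 < c" "0 < r"
  defines "m \<equiv> numerical_radius (\<lambda>x. (r / c) *\<^sub>R X (A (A x)) + (r * c) *\<^sub>R A (A (X x))) / (2 * r)"
  shows "chain_form (\<lambda>x. A (X (A x))) N x x \<le> m * chain_inner N x x"
proof -
  note linA = bounded_clinearD[OF positive_opD(1)[OF A]] and linX = bounded_clinearD[OF X]
  note symA = positive_op_inner_symmetric[OF A]
  define W where "W = (\<lambda>x. A (X (A x)))"
  let ?f = "chain_form W N" and ?i = "chain_inner N"
  have W: "bounded_clinear W"
    unfolding W_def by (intro bounded_clinear_compose[OF positive_opD(1)[OF A]]
        bounded_clinear_compose[OF X] positive_opD(1)[OF A])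
  have "0 \<le> m"
    unfolding m_def using \<open>0 < r\<close> positive_opD(1)[OF A] X
    by (intro divide_nonneg_pos numerical_radius_upper(1) bounded_clinear_weighted) auto
  obtain k where k: "0 < k" "\<And>x. norm (X x) \<le> k * norm x" using bounded_clinear_bound[OF X] by metis
  obtain a where a: "0 < a" "\<And>x. norm (A x) \<le> a * norm x"
    using bounded_clinear_bound[OF positive_opD(1)[OF A]] by metis
  obtain w where w: "0 < w" "\<And>x. norm (W x) \<le> w * norm x" using bounded_clinear_bound[OF W] by metis
  have f_le_w: "?f x x \<le> w * ?i x x" for x
    using chain_form_bound[of w W x N] w
    by (simp add: chain_form_self chain_inner_def power2_norm_eq_inner)
  have f_ge_w: "- ?f x x \<le> w * ?i x x" for x
    using chain_form_bound[of w "\<lambda>x. - W x" x N] w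
    by (simp add: chain_form_self chain_inner_def power2_norm_eq_inner sum_negf)
  \<comment> \<open>The infimum \<open>s\<close> is the larger of \<open>m\<close> and the supremum
    of the form on unit chains; the constraint \<open>m \<le> q\<close> keeps \<open>S\<close>
    bounded below even on the zero space.\<close>
  define S where "S = {q. m \<le> q \<and> (\<forall>x. ?f x x \<le> q * ?i x x)}"
  define s where "s = Inf S"
  have "?f x x \<le> max m w * ?i x x" for x
    by (rule order_trans[OF f_le_w mult_right_mono[OF _ chain_inner_nonneg]]) simp
  then have "max m w \<in> S" unfolding S_def by simp
  then have ne: "S \<noteq> {}" by blast
  have bdd: "bdd_below S" by (rule bdd_belowI[of _ m]) (simp add: S_def)
  have "m \<le> s" unfolding s_def by (rule cInf_greatest[OF ne]) (simp add: S_def)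
  have f_le_s: "?f x x \<le> s * ?i x x" for x
  proof (cases "?i x x = 0")
    case True
    then show ?thesis using f_le_w[of x] by simp
  next
    case False
    then have pos: "0 < ?i x x" using chain_inner_nonneg[of N x] by linarith
    have "?f x x / ?i x x \<le> s"
      unfolding s_def by (rule cInf_greatest[OF ne]) (use pos in \<open>simp add: S_def divide_le_eq\<close>)
    then show ?thesis using pos by (simp add: divide_le_eq)
  qed
  have "s \<le> m"
  proof (rule ccontr)
    assume "\<not> s \<le> m"
    define d where "d = s - m"
    have "0 < d" using \<open>\<not> s \<le> m\<close> by (simp add: d_def)
    \<comment> \<open>With \<open>B = A \<otimes> diag(c^n)\<close>: \<open>C\<close> bounds the
      form of \<open>s - W \<otimes> V\<close>, \<open>D\<close> bounds the squared norm of
      \<open>B^2 x\<close> by that of \<open>B x\<close>, and \<open>E\<close> undoes the weights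
      \<open>c ^ (2 * n)\<close>.\<close>
    define C where "C = s + w"
    define D where "D = a\<^sup>2 * (\<Sum>n\<le>N. c ^ (2 * n))"
    define E where "E = (\<Sum>n\<le>N. inverse (c ^ (2 * n)))"
    have nonneg: "0 \<le> C" "0 \<le> D" "0 \<le> E"
      using \<open>0 \<le> m\<close> \<open>m \<le> s\<close> w(1) \<open>0 < c\<close> by (auto simp: C_def D_def E_def intro!: sum_nonneg mult_nonneg_nonneg)
    \<comment> \<open>If \<open>s\<close> exceeded \<open>m\<close>, this estimate would force
      \<open>d\<^sup>2 * s \<le> 0\<close> as \<open>e\<close> tends to 0.\<close>
    have "d\<^sup>2 * s \<le> e * (d\<^sup>2 + C * D * (k * E))" if "0 < e" "e < d" for e
    proof -
      \<comment> \<open>Being at least \<open>m\<close>, the number \<open>s - e\<close> can only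
        fail to lie in \<open>S\<close> because some chain violates its bound; that chain is almost
        maximising.\<close>
      have "s - e \<notin> S"
        using cInf_lower[OF _ bdd] \<open>0 < e\<close> unfolding s_def[symmetric] by fastforce
      moreover have "m \<le> s - e" using \<open>e < d\<close> by (simp add: d_def)
      ultimately obtain x where x: "(s - e) * ?i x x < ?f x x" by (auto simp: S_def not_le)
      have "?i x x \<noteq> 0" using x f_le_s[of x] by auto
      then have i_pos: "0 < ?i x x" using chain_inner_nonneg[of N x] by linarith
      \<comment> \<open>\<open>v\<close> is \<open>B^2 x\<close>, so
        \<open>chain_form_weighted\<close> applies and \<open>Y\<close>, the squared norm of
        \<open>B x\<close>, equals \<open>?i x v\<close>.\<close>
      define v where "v n = c ^ (2 * n) *\<^sub>R A (A (x n))" for n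
      define Y where "Y = (\<Sum>n\<le>N. c ^ (2 * n) * (norm (A (x n)))\<^sup>2)"
      have "?i x v = Y"
        unfolding chain_inner_def v_def Y_def by (simp add: power2_norm_eq_inner symA)
      have "?f x v \<le> m * Y"
        using chain_form_weighted[OF assms(1-4), of N x] \<open>0 < r\<close>
        unfolding m_def Y_def v_def W_def by (simp add: field_simps)
      have "0 \<le> Y" unfolding Y_def using \<open>0 < c\<close> by (intro sum_nonneg) auto
      have v_le: "?i v v \<le> D * Y"
      proof -
        have "?i v v = (\<Sum>n\<le>N. c ^ (2 * n) * (c ^ (2 * n) * (norm (A (A (x n))))\<^sup>2))"
          by (simp add: chain_inner_def v_def power2_norm_eq_inner)
        also have "\<dots> \<le> (\<Sum>n\<le>N. (\<Sum>n\<le>N. c ^ (2 * n)) * (c ^ (2 * n) * (a\<^sup>2 * (norm (A (x n)))\<^sup>2)))"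
        proof (intro sum_mono mult_mono)
          fix n assume "n \<in> {..N}"
          then show "c ^ (2 * n) \<le> (\<Sum>n\<le>N. c ^ (2 * n))"
            using \<open>0 < c\<close> by (intro member_le_sum) auto
          show "(norm (A (A (x n))))\<^sup>2 \<le> a\<^sup>2 * (norm (A (x n)))\<^sup>2"
            using power_mono[OF a(2)[of "A (x n)"], of 2] by (simp add: power_mult_distrib)
        qed (use \<open>0 < c\<close> in \<open>auto intro!: sum_nonneg\<close>)
        also have "\<dots> = D * Y"
          unfolding D_def Y_def by (simp add: sum_distrib_left mult_ac)
        finally show ?thesis .
      qed
      \<comment> \<open>The form sees \<open>x\<close> only through \<open>A\<close>, so
        near-maximality at \<open>x\<close> bounds \<open>?i x x\<close> by a multiple of
        \<open>Y\<close>. This replaces invertibility of \<open>A\<close>.\<close>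
      have x_le: "?f x x \<le> k * E * Y"
      proof -
        have "?f x x = (\<Sum>n<N. inner (X (A (x n))) (A (x (Suc n))))"
          by (simp add: chain_form_self W_def symA)
        also have "\<dots> \<le> k * (\<Sum>n\<le>N. (norm (A (x n)))\<^sup>2)"
          using k by (intro chain_form_bound[of k X "\<lambda>n. A (x n)" N]) auto
        also have "(\<Sum>n\<le>N. (norm (A (x n)))\<^sup>2) \<le> (\<Sum>n\<le>N. E * (c ^ (2 * n) * (norm (A (x n)))\<^sup>2))"
        proof (rule sum_mono)
          fix n assume "n \<in> {..N}"
          then have "inverse (c ^ (2 * n)) \<le> E"
            unfolding E_def using \<open>0 < c\<close>
            by (intro member_le_sum[of n "{..N}" "\<lambda>n. inverse (c ^ (2 * n))"]) auto
          then have "1 \<le> E * c ^ (2 * n)" using \<open>0 < c\<close> by (simp add: field_simps)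
          from mult_right_mono[OF this, of "(norm (A (x n)))\<^sup>2"]
          show "(norm (A (x n)))\<^sup>2 \<le> E * (c ^ (2 * n) * (norm (A (x n)))\<^sup>2)" by (simp add: mult_ac)
        qed
        finally show ?thesis using k(1) by (simp add: Y_def sum_distrib_left mult_ac)
      qed
      have "0 < Y"
      proof -
        have "0 \<le> (s - e) * ?i x x" using \<open>m \<le> s - e\<close> \<open>0 \<le> m\<close> i_pos by simp
        then have "Y \<noteq> 0" using x x_le by auto
        with \<open>0 \<le> Y\<close> show ?thesis by simp
      qed
      \<comment> \<open>The weighted bound caps the form at \<open>x\<close> and \<open>v\<close> by
        \<open>m * Y\<close>, a gap of at least \<open>d * Y\<close> below
        \<open>s * ?i x v\<close>; Cauchy-Schwarz shows that the gap is small with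
        \<open>e\<close>.\<close>
      have "(d * Y)\<^sup>2 \<le> (s * ?i x v - ?f x v)\<^sup>2"
        using \<open>?f x v \<le> m * Y\<close> \<open>0 < d\<close> \<open>0 < Y\<close> unfolding \<open>?i x v = Y\<close>
        by (intro power_mono) (simp_all add: d_def left_diff_distrib)
      also have "\<dots> \<le> (s * ?i x x - ?f x x) * (s * ?i v v - ?f v v)"
        by (rule chain_form_cauchy_schwarz[OF bounded_linear.linear[OF bounded_clinearD(1)[OF W]] f_le_s])
      also have "\<dots> \<le> (e * ?i x x) * (C * (D * Y))"
      proof (rule mult_mono)
        show "s * ?i x x - ?f x x \<le> e * ?i x x" using x by (simp add: left_diff_distrib)
        have "s * ?i v v - ?f v v \<le> C * ?i v v" using f_ge_w[of v] by (simp add: C_def distrib_right)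
        also have "\<dots> \<le> C * (D * Y)" using nonneg v_le by (intro mult_left_mono)
        finally show "s * ?i v v - ?f v v \<le> C * (D * Y)" .
      qed (use f_le_s[of v] i_pos \<open>0 < e\<close> in auto)
      finally have "Y * (d\<^sup>2 * Y) \<le> Y * (e * ?i x x * C * D)"
        by (simp add: power2_eq_square mult_ac)
      then have dY: "d\<^sup>2 * Y \<le> e * ?i x x * C * D" using \<open>0 < Y\<close> by simp
      \<comment> \<open>Inserting the bound on \<open>d\<^sup>2 * Y\<close> leaves
        \<open>?i x x\<close> as a common factor, so the normalisation of \<open>x\<close> drops
        out.\<close>
      have "?i x x * (d\<^sup>2 * (s - e)) \<le> d\<^sup>2 * (k * E * Y)"
        using mult_left_mono[of "(s - e) * ?i x x" "k * E * Y" "d\<^sup>2"] x x_le by (simp add: mult_ac)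
      also have "\<dots> = k * E * (d\<^sup>2 * Y)" by simp
      also have "\<dots> \<le> k * E * (e * ?i x x * C * D)" using k(1) nonneg dY by (intro mult_left_mono) auto
      also have "\<dots> = ?i x x * (e * (C * D * (k * E)))" by simp
      finally have "d\<^sup>2 * (s - e) \<le> e * (C * D * (k * E))" using i_pos by (simp only: mult_le_cancel_left_pos)
      then show ?thesis by (simp add: algebra_simps)
    qed
    from le_zero_if_le_small_multiples[OF \<open>0 < d\<close> this] have "d\<^sup>2 * s \<le> 0" .
    moreover have "0 < s" using \<open>0 < d\<close> \<open>0 \<le> m\<close> by (simp add: d_def)
    ultimately show False using \<open>0 < d\<close> by (simp add: mult_le_0_iff)
  qed
  with \<open>m \<le> s\<close> f_le_s[of x] show ?thesis by (simp add: W_def)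
qed

text \<open>A geometric chain built on a unit vector \<open>u\<close> gives \<open>N\<close>
  couplings, each equal to the modulus of the form at \<open>u\<close>, against \<open>N + 1\<close>
  unit norms; large \<open>N\<close> removes the factor N/(N + 1).\<close>

lemma numerical_radius_geometric_le_weighted:
  fixes A X :: "'a::complex_hilbert_space \<Rightarrow> 'a"
  assumes A: "positive_op A" and X: "bounded_clinear X" and "0 < c" "0 < r"
  shows "2 * r * numerical_radius (\<lambda>x. A (X (A x)))
    \<le> numerical_radius (\<lambda>x. (r / c) *\<^sub>R X (A (A x)) + (r * c) *\<^sub>R A (A (X x)))"
    (is "_ * numerical_radius ?W \<le> numerical_radius ?M")
proof -
  note linA = bounded_clinearD[OF positive_opD(1)[OF A]] and linX = bounded_clinearD[OF X]
  define m where "m = numerical_radius ?M / (2 * r)"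
  have "bounded_clinear ?M"
    by (rule bounded_clinear_weighted[OF positive_opD(1)[OF A] X])
  then have "0 \<le> m"
    unfolding m_def using \<open>0 < r\<close> by (intro divide_nonneg_pos numerical_radius_upper(1)) auto
  moreover have "cmod (cinner (?W u) u) \<le> m" if u: "norm u = 1" for u
  proof -
    obtain b where b: "cmod b = 1" "b * cinner (?W u) u = of_real (cmod (cinner (?W u) u))"
      using unimodular_rotation by blast
    let ?z = "cmod (cinner (?W u) u)"
    have N: "real N * ?z \<le> m * real (Suc N)" for N
    proof -
      \<comment> \<open>The phase advances by \<open>cnj b\<close> at each index, so every coupling
        picks up exactly the factor \<open>b\<close> that makes the form real and
        nonnegative.\<close>
      define x where "x n = cnj b ^ n *\<^sub>C u" for n
      have bb: "cnj b ^ n * b ^ n = 1" for n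
        using b(1) by (simp flip: power_mult_distrib) (simp add: mult.commute complex_norm_square[symmetric])
      have "inner (?W (x n)) (x (Suc n)) = ?z" for n
      proof -
        have "cinner (?W (x n)) (x (Suc n)) = (cnj b ^ n * b ^ n) * (b * cinner (?W u) u)"
          by (simp add: x_def linA linX cinner_simps mult_ac)
        then show ?thesis unfolding bb b(2) by (simp flip: Re_cinner)
      qed
      moreover have "inner (x n) (x n) = 1" for n
        using u b(1) by (simp add: x_def norm_scaleC norm_power flip: power2_norm_eq_inner)
      ultimately show ?thesis
        using chain_form_le[OF assms, of N x]
        by (simp add: chain_form_self chain_inner_def m_def)
    qed
    show ?thesis
    proof (rule ccontr)
      assume "\<not> ?z \<le> m"
      then obtain N where "m < real N * (?z - m)" using reals_Archimedean3[of "?z - m"] by auto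
      with N[of N] show False by (simp add: algebra_simps)
    qed
  qed
  ultimately have "numerical_radius ?W \<le> m" by (rule numerical_radius_leI)
  then show ?thesis using \<open>0 < r\<close> by (simp add: m_def field_simps)
qed

section \<open>The inequalities for the mean transform\<close>

theorem theorem4p1:
  fixes T :: "'a::complex_hilbert_space \<Rightarrow> 'a" and l :: real
  assumes "bounded_clinear T" and "0 \<le> l" and "l \<le> 1"
  shows "2 * sqrt (l - l\<^sup>2) * numerical_radius (aluthge T) \<le> numerical_radius (mean_transform l T)
    \<and> numerical_radius (mean_transform l T)
        \<le> l * numerical_radius T + (1 - l) * numerical_radius (duggal T)
    \<and> 2 * sqrt (l - l\<^sup>2) * spectral_radius T \<le> numerical_radius (mean_transform l T)
    \<and> numerical_radius (mean_transform l T) \<le> numerical_radius T"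
proof -
  note T = assms(1)
  define P where "P = op_abs T"
  define U where "U = polar_isometry T"
  define A where "A = op_sqrt P"
  have P: "positive_op P" unfolding P_def by (rule positive_op_abs[OF T])
  have A: "positive_op A" and AA: "A (A x) = P x" for x
    unfolding A_def using op_sqrt_props[OF P] by auto
  note polar = polar_isometry_props[OF T, folded P_def U_def]
  note U = polar(1)
  have UP: "T = (\<lambda>x. U (P x))" using polar(3) by auto
  have duggal: "duggal T = (\<lambda>x. P (U x))" by (simp add: duggal_def P_def U_def o_def)
  have aluthge: "aluthge T = (\<lambda>x. A (U (A x)))" by (simp add: aluthge_def A_def P_def U_def o_def)
  have D: "bounded_clinear (duggal T)"
    unfolding duggal by (rule bounded_clinear_compose[OF positive_opD(1)[OF P] U])
  have M: "bounded_clinear (mean_transform l T)"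
    unfolding mean_transform_def by (intro bounded_clinear_add bounded_clinear_scaleR T D)
  note nonneg = numerical_radius_upper(1)
  have lower: "2 * sqrt (l - l\<^sup>2) * numerical_radius (aluthge T) \<le> numerical_radius (mean_transform l T)"
  \<comment> \<open>At the end points the factor \<open>sqrt (l - l\<^sup>2)\<close> vanishes, while
    \<open>c\<close> below would be 0.\<close>
  proof (cases "l = 0 \<or> l = 1")
    case True
    then show ?thesis using nonneg[OF M] by auto
  next
    case False
    then have l: "0 < l" "l < 1" using assms by auto
    \<comment> \<open>These are the positive solutions of \<open>r / c = l\<close> and
      \<open>r * c = 1 - l\<close>.\<close>
    define r where "r = sqrt (l - l\<^sup>2)"
    define c where "c = sqrt ((1 - l) / l)"
    have prod: "l - l\<^sup>2 = l * (1 - l)" by (simp add: power2_eq_square algebra_simps)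
    have "0 < c" "0 < r" using l by (simp_all add: c_def r_def prod)
    have "r / c = l" "r * c = 1 - l"
      using l by (simp_all add: r_def c_def prod real_sqrt_mult real_sqrt_divide)
    then have "mean_transform l T = (\<lambda>x. (r / c) *\<^sub>R U (A (A x)) + (r * c) *\<^sub>R A (A (U x)))"
      unfolding mean_transform_def duggal AA by (simp add: fun_eq_iff polar(3))
    then show ?thesis
      using numerical_radius_geometric_le_weighted[OF A U \<open>0 < c\<close> \<open>0 < r\<close>] by (simp add: aluthge r_def)
  qed
  have upper: "numerical_radius (mean_transform l T)
      \<le> l * numerical_radius T + (1 - l) * numerical_radius (duggal T)"
  proof (rule numerical_radius_leI)
    show "0 \<le> l * numerical_radius T + (1 - l) * numerical_radius (duggal T)"
      using assms nonneg[OF T] nonneg[OF D] by simp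
    fix x :: 'a assume x: "norm x = 1"
    have "cmod (cinner (mean_transform l T x) x)
        \<le> cmod (of_real l * cinner (T x) x) + cmod (of_real (1 - l) * cinner (duggal T x) x)"
      unfolding mean_transform_def cinner_add_left cinner_scaleR_left by (rule norm_triangle_ineq)
    also have "\<dots> = l * cmod (cinner (T x) x) + (1 - l) * cmod (cinner (duggal T x) x)"
      unfolding norm_mult norm_of_real using assms by simp
    also have "\<dots> \<le> l * numerical_radius T + (1 - l) * numerical_radius (duggal T)"
      using assms numerical_radius_upper(2)[OF T, of x] numerical_radius_upper(2)[OF D, of x] x
      by (intro add_mono mult_left_mono) auto
    finally show "cmod (cinner (mean_transform l T x) x)
        \<le> l * numerical_radius T + (1 - l) * numerical_radius (duggal T)" .
  qed
  have "numerical_radius (duggal T) \<le> numerical_radius T"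
  proof (rule numerical_radius_leI[OF nonneg[OF T]])
    fix x :: 'a assume "norm x = 1"
    then have Ux: "norm (U x) \<le> 1" using polar(2)[of x] by simp
    \<comment> \<open>\<open>U\<close> preserves inner products with vectors in the range of
      \<open>P\<close>, so it may be applied to both arguments.\<close>
    have "cinner (duggal T x) x = cinner (T (U x)) (U x)"
      using polar(4)[of "U x" x] by (simp add: duggal polar(3))
    then have "cmod (cinner (duggal T x) x) \<le> numerical_radius T * (norm (U x))\<^sup>2"
      using numerical_radius_upper(2)[OF T] by simp
    also have "\<dots> \<le> numerical_radius T"
      using Ux nonneg[OF T] by (simp add: mult_left_le power_le_one)
    finally show "cmod (cinner (duggal T x) x) \<le> numerical_radius T" .
  qed
  then have "(1 - l) * numerical_radius (duggal T) \<le> (1 - l) * numerical_radius T"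
    using assms by (intro mult_left_mono) auto
  with upper have "numerical_radius (mean_transform l T) \<le> l * numerical_radius T + (1 - l) * numerical_radius T"
    by linarith
  then have final: "numerical_radius (mean_transform l T) \<le> numerical_radius T" by (simp add: algebra_simps)
  have "spectral_radius (\<lambda>x. U (A (A x))) \<le> numerical_radius (\<lambda>x. A (U (A x)))"
    by (rule spectral_radius_le_numerical_radius_swap[OF
          bounded_clinear_compose[OF U positive_opD(1)[OF A]] positive_opD(1)[OF A]])
  then have "spectral_radius T \<le> numerical_radius (aluthge T)" by (simp add: AA aluthge flip: UP)
  then have "2 * sqrt (l - l\<^sup>2) * spectral_radius T \<le> 2 * sqrt (l - l\<^sup>2) * numerical_radius (aluthge T)"
    using assms by (intro mult_left_mono) (auto simp: power2_eq_square mult_left_le)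
  with lower upper final show ?thesis by linarith
qed

end
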